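(* Let $g_{ij}(x)$ be the metric of a Riemannian space with connection coefficients $\Gamma^i_{jk}$, $V=V(x^i)$ a function, and $\phi=\phi(t)$ a function. Consider the linearly damped system $$\frac{d^2x^i}{dt^2}+\Gamma^i_{jk}\frac{dx^j}{dt}\frac{dx^k}{dt}+\phi(t)\frac{dx^i}{dt}+V^{,i}=0. \qquad (A)$$ Let $S(t)=\int e^{-\int\phi(t)dt}\,dt$ be a solution of $\frac{d^2S}{dt^2}+\phi(t)\frac{dS}{dt}=0$, with inverse $t=S^{-1}(s)$. Then under the change of parameter $t\to s=S(t)$ the system (A) is transformed to $$\frac{d^2x^i}{ds^2}+\Gamma^i_{jk}\frac{dx^j}{ds}\frac{dx^k}{ds}+\omega(s)V^{,i}=0,\qquad \omega(s)=\Bigl(\frac{dS^{-1}(s)}{ds}\Bigr)^2. \qquad (B)$$ Consequently all Lie and Noether point symmetries of the damped system (A) are obtained from those of the time-dependent system (B) by applying the inverse transformation $t=S^{-1}(s)$.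
   Context: Everything is local and smooth; $V^{,i}=g^{ij}V_{,j}$. A Lie point symmetry of a second-order ODE system is a vector field on the space of (independent, dependent) variables whose second prolongation leaves the system invariant on solutions. A Noether point symmetry of a Lagrangian $L$ is a vector field $X=\xi\partial_t+\eta^i\partial_i$ with $X^{[1]}L+\frac{d\xi}{dt}L=\frac{df}{dt}$ for some function $f(t,x)$, where $X^{[1]}$ is the first prolongation. Noether symmetries of (B) refer to the Lagrangian $\frac12g_{ij}\frac{dx^i}{ds}\frac{dx^j}{ds}-\omega(s)V$; those of (A) refer to the Lagrangian obtained from it by the change of parameter $s=S(t)$, namely $\bigl(\frac{dS}{dt}\bigr)^{-1}\bigl(\frac12g_{ij}\dot x^i\dot x^j-V\bigr)$. *)

theory Defs
  imports "HOL-Analysis.Analysis"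
begin

section \<open>Smooth maps on open sets\<close>

fun times_differentiable_on ::
    "nat \<Rightarrow> 'a::real_normed_vector set \<Rightarrow> ('a \<Rightarrow> 'b::real_normed_vector) \<Rightarrow> bool" where
  "times_differentiable_on 0 W f \<longleftrightarrow> continuous_on W f"
| "times_differentiable_on (Suc k) W f \<longleftrightarrow>
     (\<forall>x\<in>W. f differentiable at x) \<and>
     (\<forall>v. times_differentiable_on k W (\<lambda>x. frechet_derivative f (at x) v))"

text \<open>Only used for open \<open>W\<close> in finite-dimensional spaces, where it is the class \<open>C\<close>-infinity.\<close>

definition smooth_on ::
    "'a::real_normed_vector set \<Rightarrow> ('a \<Rightarrow> 'b::real_normed_vector) \<Rightarrow> bool" where
  "smooth_on W f \<longleftrightarrow> (\<forall>k. times_differentiable_on k W f)"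

section \<open>Riemannian metrics in a coordinate chart\<close>

definition riemannian_metric_on ::
    "(real^'n) set \<Rightarrow> (real^'n \<Rightarrow> real^'n^'n) \<Rightarrow> bool" where
  "riemannian_metric_on U g \<longleftrightarrow> smooth_on U g \<and>
     (\<forall>x\<in>U. transpose (g x) = g x \<and> (\<forall>v. v \<noteq> 0 \<longrightarrow> v \<bullet> (g x *v v) > 0))"

definition pderiv_coord :: "'n \<Rightarrow> (real^'n \<Rightarrow> real) \<Rightarrow> real^'n \<Rightarrow> real" where
  "pderiv_coord i f x = frechet_derivative f (at x) (axis i 1)"

text \<open>\<open>christoffel g x i j k\<close> has upper index \<open>i\<close> and lower indices \<open>j\<close>, \<open>k\<close>.\<close>

definition christoffel ::
    "(real^'n \<Rightarrow> real^'n^'n) \<Rightarrow> real^'n \<Rightarrow> 'n \<Rightarrow> 'n \<Rightarrow> 'n \<Rightarrow> real" where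
  "christoffel g x i j k = (1/2) * (\<Sum>l\<in>UNIV. matrix_inv (g x) $ i $ l *
     (pderiv_coord j (\<lambda>y. g y $ l $ k) x + pderiv_coord k (\<lambda>y. g y $ l $ j) x
      - pderiv_coord l (\<lambda>y. g y $ j $ k) x))"

definition connection_term ::
    "(real^'n \<Rightarrow> real^'n^'n) \<Rightarrow> real^'n \<Rightarrow> real^'n \<Rightarrow> real^'n" where
  "connection_term g x v = (\<chi> i. \<Sum>j\<in>UNIV. \<Sum>k\<in>UNIV. christoffel g x i j k * v$j * v$k)"

definition metric_gradient ::
    "(real^'n \<Rightarrow> real^'n^'n) \<Rightarrow> (real^'n \<Rightarrow> real) \<Rightarrow> real^'n \<Rightarrow> real^'n" where
  "metric_gradient g V x = (\<chi> i. \<Sum>j\<in>UNIV. matrix_inv (g x) $ i $ j * pderiv_coord j V x)"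

section \<open>Second-order systems and their solutions\<close>

text \<open>
  A second-order system is given by its left-hand side \<open>E\<close> as a function of the jet coordinates
  \<open>(t, x, v, a)\<close>, where \<open>v\<close> and \<open>a\<close> stand for the first and second derivatives of the curve; the
  system is \<open>E = 0\<close>.
\<close>

type_synonym 'n system = "real \<times> (real^'n) \<times> (real^'n) \<times> (real^'n) \<Rightarrow> real^'n"

definition damped_system ::
    "(real^'n \<Rightarrow> real^'n^'n) \<Rightarrow> (real^'n \<Rightarrow> real) \<Rightarrow> (real \<Rightarrow> real) \<Rightarrow> 'n system" where
  "damped_system g V \<phi> = (\<lambda>(t, x, v, a).
     a + connection_term g x v + \<phi> t *\<^sub>R v + metric_gradient g V x)"

definition timedep_system ::
    "(real^'n \<Rightarrow> real^'n^'n) \<Rightarrow> (real^'n \<Rightarrow> real) \<Rightarrow> (real \<Rightarrow> real) \<Rightarrow> 'n system" where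
  "timedep_system g V \<omega> = (\<lambda>(s, x, v, a).
     a + connection_term g x v + \<omega> s *\<^sub>R metric_gradient g V x)"

definition solves_on :: "'n system \<Rightarrow> (real^'n) set \<Rightarrow> real set \<Rightarrow> (real \<Rightarrow> real^'n) \<Rightarrow> bool" where
  "solves_on E U J x \<longleftrightarrow> (\<exists>v a. \<forall>t\<in>J. x t \<in> U \<and>
     (x has_vector_derivative v t) (at t) \<and> (v has_vector_derivative a t) (at t) \<and>
     E (t, x t, v t, a t) = 0)"

section \<open>Point symmetries\<close>

type_synonym 'n vfield = "real \<times> (real^'n) \<Rightarrow> real \<times> (real^'n)"

definition total_deriv1 ::
    "(real \<times> (real^'n) \<Rightarrow> 'b::real_normed_vector) \<Rightarrow> real \<times> (real^'n) \<times> (real^'n) \<Rightarrow> 'b" where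
  "total_deriv1 f = (\<lambda>(t, x, v). frechet_derivative f (at (t, x)) (1, v))"

definition total_deriv2 ::
    "(real \<times> (real^'n) \<times> (real^'n) \<Rightarrow> 'b::real_normed_vector) \<Rightarrow>
     real \<times> (real^'n) \<times> (real^'n) \<times> (real^'n) \<Rightarrow> 'b" where
  "total_deriv2 h = (\<lambda>(t, x, v, a). frechet_derivative h (at (t, x, v)) (1, v, a))"

text \<open>
  For \<open>X = (\<xi>, \<eta>)\<close> the prolongation coefficients are
  \<open>\<eta>1 = d\<eta>/dt - v d\<xi>/dt\<close> and \<open>\<eta>2 = d\<eta>1/dt - a d\<xi>/dt\<close>.
\<close>

definition prol_coeff1 :: "'n vfield \<Rightarrow> real \<times> (real^'n) \<times> (real^'n) \<Rightarrow> real^'n" where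
  "prol_coeff1 X = (\<lambda>(t, x, v).
     total_deriv1 (\<lambda>p. snd (X p)) (t, x, v) - total_deriv1 (\<lambda>p. fst (X p)) (t, x, v) *\<^sub>R v)"

definition prol_coeff2 :: "'n vfield \<Rightarrow> real \<times> (real^'n) \<times> (real^'n) \<times> (real^'n) \<Rightarrow> real^'n" where
  "prol_coeff2 X = (\<lambda>(t, x, v, a).
     total_deriv2 (prol_coeff1 X) (t, x, v, a) - total_deriv1 (\<lambda>p. fst (X p)) (t, x, v) *\<^sub>R a)"

definition prolongation1 ::
    "'n vfield \<Rightarrow> real \<times> (real^'n) \<times> (real^'n) \<Rightarrow> real \<times> (real^'n) \<times> (real^'n)" where
  "prolongation1 X = (\<lambda>(t, x, v). (fst (X (t, x)), snd (X (t, x)), prol_coeff1 X (t, x, v)))"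

definition prolongation2 ::
    "'n vfield \<Rightarrow> real \<times> (real^'n) \<times> (real^'n) \<times> (real^'n) \<Rightarrow>
     real \<times> (real^'n) \<times> (real^'n) \<times> (real^'n)" where
  "prolongation2 X = (\<lambda>(t, x, v, a).
     (fst (X (t, x)), snd (X (t, x)), prol_coeff1 X (t, x, v), prol_coeff2 X (t, x, v, a)))"

definition apply_vfield ::
    "('a \<Rightarrow> 'a) \<Rightarrow> ('a::real_normed_vector \<Rightarrow> 'b::real_normed_vector) \<Rightarrow> 'a \<Rightarrow> 'b" where
  "apply_vfield Z F p = frechet_derivative F (at p) (Z p)"

text \<open>Symmetries are local: \<open>W\<close> is the open set of the \<open>(t, x)\<close>-space on which \<open>X\<close> lives.\<close>

definition lie_point_symmetry_on ::
    "'n system \<Rightarrow> (real \<times> (real^'n)) set \<Rightarrow> 'n vfield \<Rightarrow> bool" where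
  "lie_point_symmetry_on E W X \<longleftrightarrow> smooth_on W X \<and>
     (\<forall>t x v a. (t, x) \<in> W \<and> E (t, x, v, a) = 0 \<longrightarrow>
        apply_vfield (prolongation2 X) E (t, x, v, a) = 0)"

definition noether_point_symmetry_on ::
    "(real \<times> (real^'n) \<times> (real^'n) \<Rightarrow> real) \<Rightarrow> (real \<times> (real^'n)) set \<Rightarrow> 'n vfield \<Rightarrow> bool" where
  "noether_point_symmetry_on L W X \<longleftrightarrow> smooth_on W X \<and>
     (\<exists>f. smooth_on W f \<and>
        (\<forall>t x v. (t, x) \<in> W \<longrightarrow>
           apply_vfield (prolongation1 X) L (t, x, v)
           + total_deriv1 (\<lambda>p. fst (X p)) (t, x, v) * L (t, x, v) = total_deriv1 f (t, x, v)))"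

definition timedep_lagrangian ::
    "(real^'n \<Rightarrow> real^'n^'n) \<Rightarrow> (real^'n \<Rightarrow> real) \<Rightarrow> (real \<Rightarrow> real) \<Rightarrow>
     real \<times> (real^'n) \<times> (real^'n) \<Rightarrow> real" where
  "timedep_lagrangian g V \<omega> = (\<lambda>(s, x, v).
     (1/2) * (\<Sum>i\<in>UNIV. \<Sum>j\<in>UNIV. g x $ i $ j * v$i * v$j) - \<omega> s * V x)"

definition damped_lagrangian ::
    "(real^'n \<Rightarrow> real^'n^'n) \<Rightarrow> (real^'n \<Rightarrow> real) \<Rightarrow> (real \<Rightarrow> real) \<Rightarrow>
     real \<times> (real^'n) \<times> (real^'n) \<Rightarrow> real" where
  "damped_lagrangian g V S = (\<lambda>(t, x, v).
     inverse (deriv S t) * ((1/2) * (\<Sum>i\<in>UNIV. \<Sum>j\<in>UNIV. g x $ i $ j * v$i * v$j) - V x))"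

section \<open>Change of parameter\<close>

text \<open>The integrals are indefinite, so \<open>S\<close> is determined up to an affine transformation with
  positive slope.\<close>

definition damping_parameter :: "(real \<Rightarrow> real) \<Rightarrow> real set \<Rightarrow> (real \<Rightarrow> real) \<Rightarrow> bool" where
  "damping_parameter \<phi> I S \<longleftrightarrow> (\<exists>\<Phi>. \<forall>t\<in>I.
     (\<Phi> has_real_derivative \<phi> t) (at t) \<and> (S has_real_derivative exp (- \<Phi> t)) (at t))"

lemma damping_parameter_ode:
  assumes "damping_parameter \<phi> I S" "open I" "t \<in> I"
  shows "(deriv S has_real_derivative - \<phi> t * deriv S t) (at t)"
proof -
  from assms(1) obtain \<Phi> where
    d: "\<And>t. t \<in> I \<Longrightarrow> (\<Phi> has_real_derivative \<phi> t) (at t)"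
       "\<And>t. t \<in> I \<Longrightarrow> (S has_real_derivative exp (- \<Phi> t)) (at t)"
    unfolding damping_parameter_def by blast
  have S': "exp (- \<Phi> t) = deriv S t" if "t \<in> I" for t
    using d(2)[OF that] by (simp add: DERIV_imp_deriv)
  have "((\<lambda>t. exp (- \<Phi> t)) has_real_derivative exp (- \<Phi> t) * - \<phi> t) (at t)"
    using d(1)[OF assms(3)] by (auto intro!: derivative_eq_intros)
  then have "(deriv S has_real_derivative exp (- \<Phi> t) * - \<phi> t) (at t)"
    by (rule has_field_derivative_transform_within_open[OF _ assms(2,3)]) (rule S')
  then show ?thesis
    by (simp add: S'[OF assms(3)] mult.commute)
qed

text \<open>The Lagrangian one-form \<open>L ds\<close> of the time-dependent system, expressed in \<open>t\<close>.\<close>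

lemma damped_lagrangian_eq:
  assumes "deriv S t \<noteq> 0" "deriv T (S t) = inverse (deriv S t)"
  shows "damped_lagrangian g V S (t, x, v) =
    deriv S t * timedep_lagrangian g V (\<lambda>s. (deriv T s)\<^sup>2) (S t, x, inverse (deriv S t) *\<^sub>R v)"
  using assms(1) unfolding damped_lagrangian_def timedep_lagrangian_def prod.case assms(2)
  by (simp add: sum_distrib_left right_diff_distrib power2_eq_square field_simps)

definition change_param :: "(real \<Rightarrow> real) \<Rightarrow> real \<times> (real^'n) \<Rightarrow> real \<times> (real^'n)" where
  "change_param \<sigma> = (\<lambda>(t, x). (\<sigma> t, x))"

text \<open>Push-forward of the vector field \<open>Y\<close> along \<open>F\<close>, where \<open>G\<close> is the inverse of \<open>F\<close>.\<close>

definition pushforward ::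
    "('a::real_normed_vector \<Rightarrow> 'b::real_normed_vector) \<Rightarrow> ('b \<Rightarrow> 'a) \<Rightarrow> ('a \<Rightarrow> 'a) \<Rightarrow> 'b \<Rightarrow> 'b" where
  "pushforward F G Y q = frechet_derivative F (at (G q)) (Y (G q))"

end

theory Submission
  imports Defs
begin

text \<open>
  Write \<open>r = dS/dt > 0\<close>, so that \<open>dr/dt = -\<phi> r\<close>. The substitution \<open>s = S t\<close> acts on second-order jets by
  \<open>(t, x, v, a) \<mapsto> (S t, x, v/r, (a + \<phi> v)/r\<^sup>2)\<close>: the second derivative picks up the term \<open>\<phi> v\<close>
  because \<open>r\<close> itself decays at the rate \<open>\<phi>\<close>. This term is exactly the damping. As the connection
  term is quadratic in the velocity and \<open>\<omega> (S t) = 1/r\<^sup>2\<close>, the damped system is \<open>r\<^sup>2\<close> times the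
  time-dependent system composed with this jet map, and the damped Lagrangian is \<open>r\<close> times the
  time-dependent one composed with the first-order jet map (the one-form \<open>L ds\<close> is invariant);
  see \<open>damped_system_jet2\<close> and \<open>damped_lagrangian_eq\<close>.

  The statement on solutions is the chain rule for this jet map (\<open>solves_on_reparam_iff\<close>). For symmetries the point is that
  prolongation is natural: if \<open>X\<close> and \<open>Y\<close> correspond under the change of parameter, the
  differential of the jet map carries the prolongation of \<open>X\<close> to that of \<open>Y\<close>
  (\<open>prolongation1_jet1\<close>, \<open>prolongation2_jet2\<close>). Everything there follows from one observation: total
  differentiation with respect to \<open>t\<close> is \<open>r\<close> times total differentiation with respect to \<open>s\<close>.

  Given naturality, on the solution manifold the infinitesimal invariance conditions of the two
  systems differ by the factor \<open>r\<^sup>2\<close>, since the derivative of that factor is multiplied by the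
  equation itself. The two Noether conditions differ by the factor \<open>r\<close> everywhere, with gauge
  functions \<open>f\<close> that are pull-backs of each other: the derivative of \<open>r\<close> along \<open>X\<close> is absorbed by the
  difference of the total derivatives of the two time components. Because \<open>S\<close> is a smooth
  diffeomorphism onto its image, each smooth \<open>X\<close> has a smooth partner \<open>Y\<close> and conversely
  (\<open>symmetry_correspondence\<close>).

  A separate point is that Frechet derivatives of the two systems only mean something where the
  systems are differentiable; this needs differentiability of the inverse metric, which comes
  from Cramer's rule.
\<close>

section \<open>Finite-order differentiability and smoothness\<close>

text \<open>
  The successor equation would rewrite hypotheses into a form that the closure rules below, stated
  for \<open>times_differentiable_on (Suc k)\<close>, no longer match.
\<close>
declare times_differentiable_on.simps(2) [simp del]

lemma times_differentiable_on_SucD: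
  assumes "times_differentiable_on (Suc k) W f" "x \<in> W"
  shows "(f has_derivative frechet_derivative f (at x)) (at x)"
  using assms by (simp add: times_differentiable_on.simps(2) frechet_derivative_works)

lemma times_differentiable_on_SucD':
  "times_differentiable_on (Suc k) W f \<Longrightarrow> times_differentiable_on k W (\<lambda>x. frechet_derivative f (at x) v)"
  by (simp add: times_differentiable_on.simps(2))

lemma times_differentiable_on_cong:
  assumes "open W" "\<And>x. x \<in> W \<Longrightarrow> f x = g x" "times_differentiable_on k W f"
  shows "times_differentiable_on k W g"
  using assms(2,3)
proof (induction k arbitrary: f g)
  case 0
  then have "continuous_on W f" by simp
  then have "continuous_on W g" by (rule continuous_on_eq) (rule 0(1))
  then show ?case by simp
next
  case (Suc k)
  have d: "(g has_derivative frechet_derivative f (at x)) (at x)" if "x \<in> W" for x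
    by (rule has_derivative_transform_within_open[OF times_differentiable_on_SucD[OF Suc.prems(2) that] assms(1) that])
      (rule Suc.prems(1))
  have e: "frechet_derivative f (at x) = frechet_derivative g (at x)" if "x \<in> W" for x
    using frechet_derivative_at[OF d[OF that]] by simp
  have "times_differentiable_on k W (\<lambda>x. frechet_derivative g (at x) v)" for v
    by (rule Suc.IH[OF _ times_differentiable_on_SucD'[OF Suc.prems(2), of v]]) (simp add: e)
  with d show ?case by (auto simp: differentiable_def times_differentiable_on.simps(2))
qed

text \<open>
  Every closure property below is an induction on the order with this rule: the derivative of the
  combined function is again a combination of the same kind, of order one less.
\<close>
lemma times_differentiable_on_SucI:
  assumes "open W" "\<And>x. x \<in> W \<Longrightarrow> (f has_derivative f' x) (at x)"
    and "\<And>v. times_differentiable_on k W (\<lambda>x. f' x v)"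
  shows "times_differentiable_on (Suc k) W f"
proof -
  have "times_differentiable_on k W (\<lambda>x. frechet_derivative f (at x) v)" for v
    by (rule times_differentiable_on_cong[OF assms(1) _ assms(3)[of v]])
      (use frechet_derivative_at[OF assms(2)] in auto)
  with assms(2) show ?thesis by (auto simp: differentiable_def times_differentiable_on.simps(2))
qed

lemma times_differentiable_on_pred:
  "times_differentiable_on (Suc k) W f \<Longrightarrow> times_differentiable_on k W f"
  by (induction k arbitrary: f)
    (auto intro!: differentiable_imp_continuous_on
      simp: times_differentiable_on.simps(2) differentiable_on_def differentiable_at_withinI)

lemma times_differentiable_on_const:
  "open W \<Longrightarrow> times_differentiable_on k W (\<lambda>x. c)"
proof (induction k arbitrary: c)
  case (Suc k)
  then show ?case by (intro times_differentiable_on_SucI[where f' = "\<lambda>x v. 0"]) auto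
qed simp

lemma times_differentiable_on_linear:
  assumes "bounded_linear L" "open W" "times_differentiable_on k W f"
  shows "times_differentiable_on k W (\<lambda>x. L (f x))"
  using assms(3)
proof (induction k arbitrary: f)
  case 0
  then show ?case by (simp add: bounded_linear.continuous_on[OF assms(1)])
next
  case (Suc k)
  show ?case
    by (rule times_differentiable_on_SucI[OF assms(2),
          where f' = "\<lambda>x v. L (frechet_derivative f (at x) v)"])
      (use Suc in \<open>auto intro!: bounded_linear.has_derivative[OF assms(1)]
         intro: times_differentiable_on_SucD times_differentiable_on_SucD'\<close>)
qed

lemma times_differentiable_on_bounded_linear:
  assumes "bounded_linear L" "open W"
  shows "times_differentiable_on k W L"
proof (cases k)
  case 0
  then show ?thesis using assms(1) by (simp add: linear_continuous_on)
next
  case (Suc k)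
  show ?thesis unfolding Suc
    by (rule times_differentiable_on_SucI[OF assms(2), where f' = "\<lambda>x. L"])
      (auto intro: bounded_linear_imp_has_derivative assms times_differentiable_on_const)
qed

lemma times_differentiable_on_add:
  assumes "open W" "times_differentiable_on k W f" "times_differentiable_on k W g"
  shows "times_differentiable_on k W (\<lambda>x. f x + g x)"
  using assms(2,3)
proof (induction k arbitrary: f g)
  case (Suc k)
  show ?case
    by (rule times_differentiable_on_SucI[OF assms(1),
          where f' = "\<lambda>x v. frechet_derivative f (at x) v + frechet_derivative g (at x) v"])
      (use Suc in \<open>auto intro!: has_derivative_add
         intro: times_differentiable_on_SucD times_differentiable_on_SucD'\<close>)
qed (auto intro: continuous_on_add)

lemma times_differentiable_on_sum:
  assumes "open W" "\<And>i. i \<in> A \<Longrightarrow> times_differentiable_on k W (f i)"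
  shows "times_differentiable_on k W (\<lambda>x. \<Sum>i\<in>A. f i x)"
  using assms(2)
  by (induction A rule: infinite_finite_induct)
    (auto intro: times_differentiable_on_const times_differentiable_on_add assms(1))

lemma times_differentiable_on_bilinear:
  assumes "bounded_bilinear B" "open W" "times_differentiable_on k W f" "times_differentiable_on k W g"
  shows "times_differentiable_on k W (\<lambda>x. B (f x) (g x))"
  using assms(3,4)
proof (induction k arbitrary: f g)
  case 0
  then show ?case by (simp add: bounded_bilinear.continuous_on[OF assms(1)])
next
  case (Suc k)
  show ?case
    by (rule times_differentiable_on_SucI[OF assms(2),
          where f' = "\<lambda>x v. B (f x) (frechet_derivative g (at x) v) + B (frechet_derivative f (at x) v) (g x)"])
      (use Suc in \<open>auto intro!: bounded_bilinear.FDERIV[OF assms(1)] times_differentiable_on_add Suc.IH assms(2)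
         intro: times_differentiable_on_SucD times_differentiable_on_SucD' times_differentiable_on_pred\<close>)
qed

lemma times_differentiable_on_Pair:
  assumes "open W" "times_differentiable_on k W f" "times_differentiable_on k W g"
  shows "times_differentiable_on k W (\<lambda>x. (f x, g x))"
  using assms(2,3)
proof (induction k arbitrary: f g)
  case (Suc k)
  show ?case
    by (rule times_differentiable_on_SucI[OF assms(1),
          where f' = "\<lambda>x v. (frechet_derivative f (at x) v, frechet_derivative g (at x) v)"])
      (use Suc in \<open>auto intro!: has_derivative_Pair
         intro: times_differentiable_on_SucD times_differentiable_on_SucD'\<close>)
qed (auto intro: continuous_on_Pair)

text \<open>
  The definition of finite-order differentiability only differentiates in a fixed direction. The
  chain rule applies the derivative to a direction that varies with the point, and expanding this
  direction in a basis leads back to fixed directions.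
\<close>
lemma linear_basis_expansion:
  fixes L :: "'a::euclidean_space \<Rightarrow> 'b::real_normed_vector"
  assumes "linear L"
  shows "L w = (\<Sum>b\<in>Basis. (w \<bullet> b) *\<^sub>R L b)"
proof -
  have "L w = L (\<Sum>b\<in>Basis. (w \<bullet> b) *\<^sub>R b)" by (simp add: euclidean_representation)
  then show ?thesis by (simp add: linear_sum[OF assms] linear_cmul[OF assms])
qed

lemma times_differentiable_on_compose:
  fixes h :: "'a::real_normed_vector \<Rightarrow> 'b::euclidean_space"
  assumes "open W" "open W'" "h ` W \<subseteq> W'"
    and "times_differentiable_on k W' f" "times_differentiable_on k W h"
  shows "times_differentiable_on k W (\<lambda>x. f (h x))"
  using assms(4,5)
proof (induction k arbitrary: f)
  case 0
  then show ?case using assms(3) by (auto intro: continuous_on_compose2)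
next
  case (Suc k)
  let ?D = "\<lambda>x v. \<Sum>b\<in>Basis. (frechet_derivative h (at x) v \<bullet> b) *\<^sub>R frechet_derivative f (at (h x)) b"
  have d: "((\<lambda>x. f (h x)) has_derivative ?D x) (at x)" if "x \<in> W" for x
  proof -
    have f: "(f has_derivative frechet_derivative f (at (h x))) (at (h x))"
      using Suc.prems(1) assms(3) that by (intro times_differentiable_on_SucD) auto
    have "((\<lambda>x. f (h x)) has_derivative (\<lambda>v. frechet_derivative f (at (h x)) (frechet_derivative h (at x) v))) (at x)"
      by (rule has_derivative_compose[OF times_differentiable_on_SucD[OF Suc.prems(2) that] f])
    moreover have "frechet_derivative f (at (h x)) (frechet_derivative h (at x) v) = ?D x v" for v
      by (rule linear_basis_expansion[OF has_derivative_linear[OF f]])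
    ultimately show ?thesis by simp
  qed
  have "times_differentiable_on k W (\<lambda>x. frechet_derivative f (at (h x)) b)" for b
    by (rule Suc.IH[OF times_differentiable_on_SucD'[OF Suc.prems(1)] times_differentiable_on_pred[OF Suc.prems(2)]])
  moreover have "times_differentiable_on k W (\<lambda>x. frechet_derivative h (at x) v \<bullet> b)" for v b
    using Suc.prems
    by (intro times_differentiable_on_linear[OF bounded_linear_inner_left assms(1)] times_differentiable_on_SucD')
  ultimately show ?case
    by (intro times_differentiable_on_SucI[OF assms(1) d] times_differentiable_on_sum[OF assms(1)]
          times_differentiable_on_bilinear[OF bounded_bilinear_scaleR assms(1)])
qed

lemma smooth_on_cong:
  "open W \<Longrightarrow> (\<And>x. x \<in> W \<Longrightarrow> f x = g x) \<Longrightarrow> smooth_on W f \<Longrightarrow> smooth_on W g"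
  unfolding smooth_on_def using times_differentiable_on_cong by blast

lemma smooth_on_compose:
  fixes h :: "'a::real_normed_vector \<Rightarrow> 'b::euclidean_space"
  assumes "open W" "open W'" "h ` W \<subseteq> W'" "smooth_on W' f" "smooth_on W h"
  shows "smooth_on W (\<lambda>x. f (h x))"
  using assms times_differentiable_on_compose unfolding smooth_on_def by blast

lemma smooth_on_linear:
  "bounded_linear L \<Longrightarrow> open W \<Longrightarrow> smooth_on W f \<Longrightarrow> smooth_on W (\<lambda>x. L (f x))"
  unfolding smooth_on_def using times_differentiable_on_linear by blast

lemma smooth_on_mult:
  fixes f :: "'a::real_normed_vector \<Rightarrow> real"
  shows "open W \<Longrightarrow> smooth_on W f \<Longrightarrow> smooth_on W g \<Longrightarrow> smooth_on W (\<lambda>x. f x * g x)"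
  unfolding smooth_on_def using times_differentiable_on_bilinear[OF bounded_bilinear_mult] by blast

lemma smooth_on_Pair:
  "open W \<Longrightarrow> smooth_on W f \<Longrightarrow> smooth_on W g \<Longrightarrow> smooth_on W (\<lambda>x. (f x, g x))"
  unfolding smooth_on_def using times_differentiable_on_Pair by blast

lemma smooth_on_imp_has_derivative:
  "smooth_on W f \<Longrightarrow> x \<in> W \<Longrightarrow> (f has_derivative frechet_derivative f (at x)) (at x)"
  unfolding smooth_on_def using times_differentiable_on_SucD by blast

lemma smooth_on_frechet_derivative:
  "smooth_on W f \<Longrightarrow> smooth_on W (\<lambda>x. frechet_derivative f (at x) v)"
  unfolding smooth_on_def using times_differentiable_on_SucD' by blast

text \<open>
  Total derivatives are Frechet derivatives applied to the moving direction \<open>(1, v)\<close>; this makes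
  the first prolongation coefficient differentiable, as the second one requires.
\<close>
lemma differentiable_frechet_derivative_apply:
  fixes f :: "'a::euclidean_space \<Rightarrow> 'b::real_normed_vector"
  assumes "open W" "smooth_on W f" "\<pi> q \<in> W" "\<pi> differentiable at q" "w differentiable at q"
  shows "(\<lambda>q. frechet_derivative f (at (\<pi> q)) (w q)) differentiable at q"
proof -
  let ?h = "\<lambda>q. \<Sum>b\<in>Basis. (w q \<bullet> b) *\<^sub>R frechet_derivative f (at (\<pi> q)) b"
  have "(\<lambda>q. frechet_derivative f (at (\<pi> q)) b) differentiable at q" for b
    using differentiable_chain_at[OF assms(4), of "\<lambda>p. frechet_derivative f (at p) b"]
      smooth_on_imp_has_derivative[OF smooth_on_frechet_derivative[OF assms(2)] assms(3), of b]
    by (auto simp: o_def differentiable_def)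
  moreover have "(\<lambda>q. w q \<bullet> b) differentiable at q" for b
    using assms(5) by (auto intro!: differentiable_inner)
  ultimately have h: "?h differentiable at q"
    by (intro differentiable_sum differentiable_scaleR) auto
  have "\<pi> \<midarrow>q\<rightarrow> \<pi> q"
    using differentiable_imp_continuous_within[OF assms(4)] by (simp add: continuous_at)
  then have "\<forall>\<^sub>F q' in at q. \<pi> q' \<in> W"
    using assms(1,3) topological_tendstoD by blast
  then have "\<forall>\<^sub>F q' in at q. ?h q' = frechet_derivative f (at (\<pi> q')) (w q')"
    by (rule eventually_mono)
      (simp add: linear_basis_expansion[OF has_derivative_linear[OF smooth_on_imp_has_derivative[OF assms(2)]], symmetric])
  moreover have "?h q = frechet_derivative f (at (\<pi> q)) (w q)"
    by (simp add: linear_basis_expansion[OF has_derivative_linear[OF smooth_on_imp_has_derivative[OF assms(2,3)]], symmetric])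
  ultimately show ?thesis
    using h by (auto simp: differentiable_def intro: has_derivative_transform_eventually)
qed

lemma times_differentiable_on_real_SucI:
  fixes f :: "real \<Rightarrow> real"
  assumes "open W" "\<And>x. x \<in> W \<Longrightarrow> (f has_real_derivative f' x) (at x)"
    and "times_differentiable_on k W f'"
  shows "times_differentiable_on (Suc k) W f"
  using assms
  by (intro times_differentiable_on_SucI[where f' = "\<lambda>x v. f' x * v"]
      times_differentiable_on_bilinear[OF bounded_bilinear_mult] times_differentiable_on_const)
    (auto simp: has_field_derivative_def)

lemma smooth_on_real_has_derivative:
  fixes f :: "real \<Rightarrow> real"
  assumes "smooth_on W f" "t \<in> W"
  shows "(f has_real_derivative deriv f t) (at t)"
  unfolding DERIV_deriv_iff_real_differentiable differentiable_def
  using smooth_on_imp_has_derivative[OF assms] by blast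

lemma has_derivative_change_param:
  assumes "(\<sigma> has_real_derivative d) (at t)"
  shows "(change_param \<sigma> has_derivative (\<lambda>(\<tau>, \<zeta>). (d * \<tau>, \<zeta>))) (at (t, x))"
proof -
  have "((\<lambda>p. \<sigma> (fst p)) has_derivative (\<lambda>h. d * fst h)) (at (t, x))"
    by (rule has_derivative_compose[where f = fst and g = \<sigma> and x = "(t, x)" and s = UNIV, simplified])
      (use assms in \<open>auto simp: has_field_derivative_def intro!: has_derivative_fst has_derivative_ident\<close>)
  then have "((\<lambda>p. (\<sigma> (fst p), snd p)) has_derivative (\<lambda>h. (d * fst h, snd h))) (at (t, x))"
    by (intro has_derivative_Pair) (auto intro!: derivative_intros)
  then show ?thesis unfolding change_param_def case_prod_unfold .
qed

lemma pushforward_change_param: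
  assumes "(\<sigma> has_real_derivative d) (at t)" "G p = (t, x)"
  shows "pushforward (change_param \<sigma>) G Z p = (d * fst (Z (t, x)), snd (Z (t, x)))"
  by (simp add: pushforward_def case_prod_unfold assms(2)
      frechet_derivative_at[OF has_derivative_change_param[OF assms(1), of x], symmetric])

lemma smooth_on_change_param:
  fixes \<sigma> :: "real \<Rightarrow> real" and W :: "(real \<times> (real^'n)) set"
  assumes "open W" "open J" "fst ` W \<subseteq> J" "smooth_on J \<sigma>"
  shows "smooth_on W (change_param \<sigma>)"
proof -
  have "smooth_on W fst" "smooth_on W snd"
    using assms(1) unfolding smooth_on_def
    by (auto intro: times_differentiable_on_bounded_linear bounded_linear_fst bounded_linear_snd)
  then have "smooth_on W (\<lambda>p. (\<sigma> (fst p), snd p))"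
    by (intro smooth_on_Pair[OF assms(1)] smooth_on_compose[OF assms])
  then show ?thesis unfolding change_param_def case_prod_unfold .
qed

section \<open>The new parameter and its inverse\<close>

locale damping_clock =
  fixes I :: "real set" and \<phi> S T :: "real \<Rightarrow> real"
  assumes open_I: "open I" and smooth_phi: "smooth_on I \<phi>"
    and damping: "damping_parameter \<phi> I S" and inverse_S: "t \<in> I \<Longrightarrow> T (S t) = t"
begin

abbreviation "rate \<equiv> deriv S"

lemma DERIV_S: "(S has_real_derivative rate t) (at t)"
  and rate_pos: "rate t > 0" if "t \<in> I"
proof -
  obtain \<Phi> where "\<forall>t\<in>I. (\<Phi> has_real_derivative \<phi> t) (at t) \<and> (S has_real_derivative exp (- \<Phi> t)) (at t)"
    using damping unfolding damping_parameter_def by (rule exE)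
  with that have "(S has_real_derivative exp (- \<Phi> t)) (at t)" by simp
  then show "(S has_real_derivative rate t) (at t)" "rate t > 0"
    by (simp_all add: DERIV_imp_deriv)
qed

lemmas DERIV_rate = damping_parameter_ode[OF damping open_I]

lemma DERIV_inverse_rate:
  assumes "t \<in> I"
  shows "((\<lambda>t. inverse (rate t)) has_real_derivative \<phi> t * inverse (rate t)) (at t)"
  using rate_pos[OF assms]
  by (auto intro!: derivative_eq_intros DERIV_rate[OF assms] simp: field_simps)

lemma continuous_on_S: "continuous_on I S"
  by (meson DERIV_S DERIV_continuous_on has_field_derivative_at_within)

lemma DERIV_T:
  assumes "t \<in> I"
  shows "(T has_real_derivative inverse (rate t)) (at (S t))"
  unfolding has_field_derivative_def
  by (rule has_derivative_inverse_strong[OF open_I assms continuous_on_S])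
    (use DERIV_S[OF assms] rate_pos[OF assms] inverse_S in \<open>auto simp: has_field_derivative_def fun_eq_iff\<close>)

lemma open_image_S:
  assumes "open J" "J \<subseteq> I"
  shows "open (S ` J)"
proof (rule invariance_of_domain[OF _ assms(1)])
  show "continuous_on J S" using continuous_on_S assms(2) continuous_on_subset by blast
  show "inj_on S J" using inverse_S assms(2) by (metis inj_on_inverseI subsetD)
qed

text \<open>
  Bootstrapping: the derivative of the rate is \<open>-\<phi>\<close> times the rate, so each order of
  differentiability yields the next.
\<close>
lemma smooth_rate: "smooth_on I rate"
proof -
  have "times_differentiable_on k I rate" for k
  proof (induction k)
    case 0
    show ?case
      using DERIV_continuous_on[OF has_field_derivative_at_within[OF DERIV_rate]] by simp
  next
    case (Suc k)
    have "times_differentiable_on k I (\<lambda>t. - \<phi> t)"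
      using smooth_phi times_differentiable_on_linear[OF bounded_linear_minus[OF bounded_linear_ident] open_I]
      unfolding smooth_on_def by blast
    then show ?case
      by (intro times_differentiable_on_real_SucI[OF open_I DERIV_rate]
          times_differentiable_on_bilinear[OF bounded_bilinear_mult open_I] Suc)
  qed
  then show ?thesis by (simp add: smooth_on_def)
qed

lemma smooth_S: "smooth_on I S"
proof -
  have "times_differentiable_on (Suc k) I S" for k
    using smooth_rate by (intro times_differentiable_on_real_SucI[OF open_I DERIV_S]) (auto simp: smooth_on_def)
  then show ?thesis using times_differentiable_on_pred smooth_on_def by blast
qed

text \<open>
  The inverse is bootstrapped together with its derivative \<open>e s = 1 / rate (T s)\<close>, which satisfies
  \<open>e' = \<phi> (T s) e\<^sup>2\<close>.
\<close>
lemma smooth_T: "smooth_on (S ` I) T"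
proof -
  let ?e = "\<lambda>s. inverse (rate (T s))"
  note op = open_image_S[OF open_I order_refl]
  have T: "(T has_real_derivative ?e s) (at s)" if "s \<in> S ` I" for s
    using that DERIV_T inverse_S by auto
  have e: "(?e has_real_derivative \<phi> (T s) * (?e s * ?e s)) (at s)" if "s \<in> S ` I" for s
  proof -
    have "T s \<in> I" using that inverse_S by auto
    from DERIV_chain2[OF DERIV_inverse_rate[OF this] T[OF that]] show ?thesis
      by (simp add: mult.assoc)
  qed
  have "times_differentiable_on k (S ` I) T \<and> times_differentiable_on k (S ` I) ?e" for k
  proof (induction k)
    case 0
    show ?case
      using DERIV_continuous_on[OF has_field_derivative_at_within[OF T]]
        DERIV_continuous_on[OF has_field_derivative_at_within[OF e]] by simp
  next
    case (Suc k)
    have "times_differentiable_on k (S ` I) (\<lambda>s. \<phi> (T s))"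
      by (rule times_differentiable_on_compose[OF op open_I])
        (use smooth_phi Suc inverse_S in \<open>auto simp: smooth_on_def\<close>)
    then show ?case
      using Suc by (intro conjI times_differentiable_on_real_SucI[OF op T] times_differentiable_on_real_SucI[OF op e]
          times_differentiable_on_bilinear[OF bounded_bilinear_mult op]) auto
  qed
  then show ?thesis by (simp add: smooth_on_def)
qed

lemma change_param_inverse: "p \<in> I \<times> UNIV \<Longrightarrow> change_param T (change_param S p) = p"
  by (auto simp: change_param_def inverse_S)

lemma open_image_change_param:
  fixes W :: "(real \<times> (real^'n)) set"
  assumes "open W" "W \<subseteq> I \<times> UNIV"
  shows "open (change_param S ` W)"
proof (rule invariance_of_domain[OF _ assms(1)])
  show "continuous_on W (change_param S)"
    unfolding change_param_def case_prod_unfold using assms(2)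
    by (intro continuous_on_Pair continuous_on_compose2[OF continuous_on_S] continuous_intros) auto
  show "inj_on (change_param S) W"
    using change_param_inverse assms(2) by (metis inj_on_inverseI subsetD)
qed

lemma smooth_on_reparam:
  fixes W :: "(real \<times> (real^'n)) set"
  assumes "open W" "W \<subseteq> I \<times> UNIV" "smooth_on (change_param S ` W) f"
  shows "smooth_on W (\<lambda>p. f (change_param S p))"
  using assms
  by (intro smooth_on_compose[OF assms(1) open_image_change_param[OF assms(1,2)] order_refl assms(3)]
      smooth_on_change_param[OF assms(1) open_I _ smooth_S]) auto

lemma smooth_on_reparam_inverse:
  fixes W :: "(real \<times> (real^'n)) set"
  assumes "open W" "W \<subseteq> I \<times> UNIV" "smooth_on W f"
  shows "smooth_on (change_param S ` W) (\<lambda>p. f (change_param T p))"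
proof (rule smooth_on_compose[OF open_image_change_param[OF assms(1,2)] assms(1) _ assms(3)])
  show "change_param T ` change_param S ` W \<subseteq> W"
  proof (unfold image_image, rule image_subsetI)
    fix p assume "p \<in> W"
    moreover from this have "change_param T (change_param S p) = p"
      using assms(2) by (intro change_param_inverse) auto
    ultimately show "change_param T (change_param S p) \<in> W" by simp
  qed
  show "smooth_on (change_param S ` W) (change_param T)"
    by (rule smooth_on_change_param[OF open_image_change_param[OF assms(1,2)] open_image_S[OF open_I order_refl] _ smooth_T])
      (use assms(2) in \<open>auto simp: change_param_def\<close>)
qed

end

section \<open>Action of the reparametrization on jets\<close>

context damping_clock
begin

text \<open>
  The two jet maps express position, velocity and acceleration with respect to \<open>s\<close> through those
  with respect to \<open>t\<close>: \<open>dx/ds = v / r\<close>, and differentiating once more with \<open>dr/dt = -\<phi> r\<close> gives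
  \<open>d\<^sup>2x/ds\<^sup>2 = (a + \<phi> v) / r\<^sup>2\<close>.
\<close>
definition jet1 :: "real \<times> (real^'n) \<times> (real^'n) \<Rightarrow> real \<times> (real^'n) \<times> (real^'n)" where
  "jet1 = (\<lambda>(t, x, v). (S t, x, inverse (rate t) *\<^sub>R v))"

definition jet2 ::
  "real \<times> (real^'n) \<times> (real^'n) \<times> (real^'n) \<Rightarrow> real \<times> (real^'n) \<times> (real^'n) \<times> (real^'n)" where
  "jet2 = (\<lambda>(t, x, v, a).
     (S t, x, inverse (rate t) *\<^sub>R v, (inverse (rate t))\<^sup>2 *\<^sub>R (a + \<phi> t *\<^sub>R v)))"

lemma has_derivative_of_time:
  assumes "(f has_real_derivative d) (at (fst p))"
  shows "((\<lambda>p. f (fst p)) has_derivative (\<lambda>h. d * fst h)) (at p)"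
  by (rule has_derivative_compose[where f = fst and g = f and x = p and s = UNIV, simplified])
    (use assms in \<open>auto simp: has_field_derivative_def intro!: has_derivative_fst has_derivative_ident\<close>)

lemma has_derivative_jet1:
  fixes x v :: "real^'n"
  assumes "t \<in> I"
  shows "(jet1 has_derivative (\<lambda>(\<tau>, \<zeta>, \<nu>). (rate t * \<tau>, \<zeta>,
     inverse (rate t) *\<^sub>R (\<nu> + (\<phi> t * \<tau>) *\<^sub>R v)))) (at (t, x, v))"
proof -
  let ?q = "(t, x, v)"
  have St: "((\<lambda>q. S (fst q)) has_derivative (\<lambda>h. rate t * fst h)) (at ?q)"
    using has_derivative_of_time[of S "rate t" ?q] DERIV_S[OF assms] by simp
  have e: "((\<lambda>q. inverse (rate (fst q))) has_derivative (\<lambda>h. \<phi> t * inverse (rate t) * fst h)) (at ?q)"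
    using has_derivative_of_time[of "\<lambda>t. inverse (rate t)" _ ?q] DERIV_inverse_rate[OF assms] by simp
  have v: "((\<lambda>q. snd (snd q)) has_derivative (\<lambda>h. snd (snd h))) (at ?q)"
    and x: "((\<lambda>q. fst (snd q)) has_derivative (\<lambda>h. fst (snd h))) (at ?q)"
    by (intro has_derivative_fst has_derivative_snd has_derivative_ident)+
  show ?thesis
    unfolding jet1_def case_prod_unfold
    by (rule has_derivative_eq_rhs[OF has_derivative_Pair[OF St has_derivative_Pair[OF x has_derivative_scaleR[OF e v]]]])
      (simp add: fun_eq_iff algebra_simps)
qed

lemma has_derivative_jet2:
  fixes x v a :: "real^'n"
  assumes "t \<in> I"
  shows "(jet2 has_derivative (\<lambda>(\<tau>, \<zeta>, \<nu>, \<alpha>). (rate t * \<tau>, \<zeta>,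
     inverse (rate t) *\<^sub>R (\<nu> + (\<phi> t * \<tau>) *\<^sub>R v),
     (inverse (rate t))\<^sup>2 *\<^sub>R (\<alpha> + \<phi> t *\<^sub>R \<nu> + (deriv \<phi> t * \<tau>) *\<^sub>R v
       + (2 * \<phi> t * \<tau>) *\<^sub>R (a + \<phi> t *\<^sub>R v))))) (at (t, x, v, a))"
proof -
  let ?q = "(t, x, v, a)"
  have St: "((\<lambda>q. S (fst q)) has_derivative (\<lambda>h. rate t * fst h)) (at ?q)"
    using has_derivative_of_time[of S "rate t" ?q] DERIV_S[OF assms] by simp
  have e: "((\<lambda>q. inverse (rate (fst q))) has_derivative (\<lambda>h. \<phi> t * inverse (rate t) * fst h)) (at ?q)"
    using has_derivative_of_time[of "\<lambda>t. inverse (rate t)" _ ?q] DERIV_inverse_rate[OF assms] by simp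
  have \<phi>: "((\<lambda>q. \<phi> (fst q)) has_derivative (\<lambda>h. deriv \<phi> t * fst h)) (at ?q)"
    using has_derivative_of_time[of \<phi> _ ?q] smooth_on_real_has_derivative[OF smooth_phi assms] by simp
  have e2: "((\<lambda>q. (inverse (rate (fst q)))\<^sup>2) has_derivative
      (\<lambda>h. 2 * \<phi> t * (inverse (rate t))\<^sup>2 * fst h)) (at ?q)"
    unfolding power2_eq_square
    by (rule has_derivative_eq_rhs[OF has_derivative_mult[OF e e]]) (simp add: fun_eq_iff algebra_simps)
  have x: "((\<lambda>q. fst (snd q)) has_derivative (\<lambda>h. fst (snd h))) (at ?q)"
    and v: "((\<lambda>q. fst (snd (snd q))) has_derivative (\<lambda>h. fst (snd (snd h)))) (at ?q)"
    and a: "((\<lambda>q. snd (snd (snd q))) has_derivative (\<lambda>h. snd (snd (snd h)))) (at ?q)"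
    by (intro has_derivative_fst has_derivative_snd has_derivative_ident)+
  show ?thesis
    unfolding jet2_def case_prod_unfold
    by (rule has_derivative_eq_rhs[OF has_derivative_Pair[OF St has_derivative_Pair[OF x
          has_derivative_Pair[OF has_derivative_scaleR[OF e v]
            has_derivative_scaleR[OF e2 has_derivative_add[OF a has_derivative_scaleR[OF \<phi> v]]]]]]])
      (simp add: fun_eq_iff algebra_simps)
qed

text \<open>
  The vector \<open>(1, v)\<close> of the total derivative in \<open>t\<close> is sent by the differential of the change of
  parameter to \<open>rate t\<close> times the vector \<open>(1, v / rate t)\<close> of the total derivative in \<open>s\<close>.
\<close>
lemma total_deriv1_reparam:
  fixes f h :: "real \<times> (real^'n) \<Rightarrow> 'b::real_normed_vector"
  assumes "t \<in> I" "open W" "(t, x) \<in> W" "\<And>p. p \<in> W \<Longrightarrow> h p = f (change_param S p)"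
    and "(f has_derivative f') (at (S t, x))"
  shows "total_deriv1 h (t, x, v) = rate t *\<^sub>R total_deriv1 f (jet1 (t, x, v))"
proof -
  have "((\<lambda>p. f (change_param S p)) has_derivative (\<lambda>k. f' (case k of (\<tau>, \<zeta>) \<Rightarrow> (rate t * \<tau>, \<zeta>)))) (at (t, x))"
    using has_derivative_compose[OF has_derivative_change_param[OF DERIV_S[OF assms(1)], of x], of f f'] assms(5)
    by (simp add: change_param_def)
  then have "(h has_derivative (\<lambda>k. f' (case k of (\<tau>, \<zeta>) \<Rightarrow> (rate t * \<tau>, \<zeta>)))) (at (t, x))"
    by (rule has_derivative_transform_within_open[OF _ assms(2,3)]) (simp add: assms(4))
  then have "total_deriv1 h (t, x, v) = f' (rate t, v)"
    by (simp add: total_deriv1_def frechet_derivative_at[symmetric])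
  also have "\<dots> = f' (rate t *\<^sub>R (1, inverse (rate t) *\<^sub>R v))"
    using rate_pos[OF assms(1)] by simp
  also have "\<dots> = rate t *\<^sub>R total_deriv1 f (jet1 (t, x, v))"
    by (simp only: total_deriv1_def jet1_def prod.case
        frechet_derivative_at[OF assms(5), symmetric] linear_cmul[OF has_derivative_linear[OF assms(5)]])
  finally show ?thesis .
qed

text \<open>
  The same one order higher: the last component of \<open>jet2\<close> is the one that makes the differential
  of \<open>jet1\<close> send \<open>(1, v, a)\<close> to \<open>rate t\<close> times the total derivative direction in \<open>s\<close>.
\<close>
lemma total_deriv2_reparam:
  fixes f h :: "real \<times> (real^'n) \<times> (real^'n) \<Rightarrow> 'b::real_normed_vector"
  assumes "t \<in> I" "open W" "(t, x, v) \<in> W" "\<And>p. p \<in> W \<Longrightarrow> h p = f (jet1 p)"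
    and "f differentiable at (jet1 (t, x, v))"
  shows "total_deriv2 h (t, x, v, a) = rate t *\<^sub>R total_deriv2 f (jet2 (t, x, v, a))"
proof -
  have rate: "rate t * (inverse (rate t))\<^sup>2 = inverse (rate t)"
    using rate_pos[OF assms(1)] by (simp add: power2_eq_square field_simps)
  from assms(5) obtain f' where f': "(f has_derivative f') (at (jet1 (t, x, v)))"
    by (auto simp: differentiable_def)
  let ?J = "\<lambda>(\<tau>, \<zeta>, \<nu>). (rate t * \<tau>, \<zeta>, inverse (rate t) *\<^sub>R (\<nu> + (\<phi> t * \<tau>) *\<^sub>R v))"
  have "(h has_derivative (\<lambda>k. f' (?J k))) (at (t, x, v))"
    by (rule has_derivative_transform_within_open[OF
          has_derivative_compose[OF has_derivative_jet1[OF assms(1), of v x] f'] assms(2,3)]) (simp add: assms(4))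
  then have "total_deriv2 h (t, x, v, a) = f' (rate t, v, inverse (rate t) *\<^sub>R (a + \<phi> t *\<^sub>R v))"
    by (simp add: total_deriv2_def frechet_derivative_at[symmetric])
  also have "\<dots> = f' (rate t *\<^sub>R (1, inverse (rate t) *\<^sub>R v, (inverse (rate t))\<^sup>2 *\<^sub>R (a + \<phi> t *\<^sub>R v)))"
    using rate_pos[OF assms(1)] rate by simp
  also have "\<dots> = rate t *\<^sub>R total_deriv2 f (jet2 (t, x, v, a))"
    using frechet_derivative_at[OF f'] linear_cmul[OF has_derivative_linear[OF f']]
    by (simp only: total_deriv2_def jet1_def jet2_def prod.case)
  finally show ?thesis .
qed

end

section \<open>Naturality of prolongation\<close>

text \<open>
  The condition on \<open>Y\<close> says that \<open>Y\<close> is the push-forward of \<open>X\<close> under \<open>(t, x) \<mapsto> (S t, x)\<close>, in a form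
  that involves no derivative of the inverse \<open>T\<close>.
\<close>
locale corresponding_fields = damping_clock I \<phi> S T
  for I :: "real set" and \<phi> S T :: "real \<Rightarrow> real" +
  fixes W :: "(real \<times> (real^'n)) set" and X Y :: "'n vfield"
  assumes open_W: "open W" and W_I: "W \<subseteq> I \<times> UNIV"
    and smooth_X: "smooth_on W X" and smooth_Y: "smooth_on (change_param S ` W) Y"
    and Y_eq: "(t, x) \<in> W \<Longrightarrow> Y (S t, x) = (rate t * fst (X (t, x)), snd (X (t, x)))"
begin

lemma time_in_I: "(t, x) \<in> W \<Longrightarrow> t \<in> I"
  using W_I by auto

lemma image_in_SW: "(t, x) \<in> W \<Longrightarrow> (S t, x) \<in> change_param S ` W"
  by (force simp: change_param_def)

lemmas open_SW = open_image_change_param[OF open_W W_I]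

lemma smooth_components:
  "smooth_on W (\<lambda>p. fst (X p))" "smooth_on W (\<lambda>p. snd (X p))"
  "smooth_on (change_param S ` W) (\<lambda>p. fst (Y p))" "smooth_on (change_param S ` W) (\<lambda>p. snd (Y p))"
  by (intro smooth_on_linear[OF bounded_linear_fst] smooth_on_linear[OF bounded_linear_snd]
      open_W open_SW smooth_X smooth_Y)+

text \<open>
  The time component of \<open>Y\<close>, read in \<open>t\<close>, is \<open>rate\<close> times that of \<open>X\<close>. The product rule gives the
  correction \<open>-\<phi> \<xi>\<close>, the source of every \<open>\<xi>\<close>-dependent term in the coefficients below.
\<close>
lemma total_deriv_xi:
  assumes "(t, x) \<in> W"
  shows "total_deriv1 (\<lambda>p. fst (Y p)) (jet1 (t, x, v))
    = total_deriv1 (\<lambda>p. fst (X p)) (t, x, v) - \<phi> t * fst (X (t, x))"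
proof -
  note I = time_in_I[OF assms]
  let ?h = "\<lambda>p. rate (fst p) * fst (X p)"
  have r: "((\<lambda>p. rate (fst p)) has_derivative (\<lambda>k. (- \<phi> t * rate t) * fst k)) (at (t, x))"
    by (rule has_derivative_of_time) (use DERIV_rate[OF I] in simp)
  have \<xi>: "((\<lambda>p. fst (X p)) has_derivative frechet_derivative (\<lambda>p. fst (X p)) (at (t, x))) (at (t, x))"
    by (rule smooth_on_imp_has_derivative[OF smooth_components(1) assms])
  have "total_deriv1 ?h (t, x, v) = rate t * total_deriv1 (\<lambda>p. fst (X p)) (t, x, v) - \<phi> t * rate t * fst (X (t, x))"
    by (simp add: total_deriv1_def frechet_derivative_at[OF has_derivative_mult[OF r \<xi>], symmetric])
  moreover have "total_deriv1 ?h (t, x, v) = rate t *\<^sub>R total_deriv1 (\<lambda>p. fst (Y p)) (jet1 (t, x, v))"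
    by (rule total_deriv1_reparam[OF I open_W assms _
          smooth_on_imp_has_derivative[OF smooth_components(3) image_in_SW[OF assms]]])
      (auto simp: change_param_def Y_eq)
  ultimately have "rate t * total_deriv1 (\<lambda>p. fst (Y p)) (jet1 (t, x, v))
      = rate t * (total_deriv1 (\<lambda>p. fst (X p)) (t, x, v) - \<phi> t * fst (X (t, x)))"
    by (simp add: algebra_simps)
  then show ?thesis using rate_pos[OF I] by simp
qed

lemma total_deriv_eta:
  assumes "(t, x) \<in> W"
  shows "total_deriv1 (\<lambda>p. snd (Y p)) (jet1 (t, x, v))
    = inverse (rate t) *\<^sub>R total_deriv1 (\<lambda>p. snd (X p)) (t, x, v)"
proof -
  note I = time_in_I[OF assms]
  have "total_deriv1 (\<lambda>p. snd (X p)) (t, x, v) = rate t *\<^sub>R total_deriv1 (\<lambda>p. snd (Y p)) (jet1 (t, x, v))"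
    by (rule total_deriv1_reparam[OF I open_W assms _
          smooth_on_imp_has_derivative[OF smooth_components(4) image_in_SW[OF assms]]])
      (auto simp: change_param_def Y_eq)
  then show ?thesis using rate_pos[OF I] by simp
qed

lemma prol_coeff1_jet1:
  assumes "(t, x) \<in> W"
  shows "prol_coeff1 Y (jet1 (t, x, v))
    = inverse (rate t) *\<^sub>R (prol_coeff1 X (t, x, v) + (\<phi> t * fst (X (t, x))) *\<^sub>R v)"
  by (simp add: prol_coeff1_def jet1_def algebra_simps
      total_deriv_xi[OF assms, unfolded jet1_def prod.case] total_deriv_eta[OF assms, unfolded jet1_def prod.case])

text \<open>
  The term \<open>\<phi> \<xi> v\<close> of the preceding lemma is what the differential of \<open>v / rate t\<close> contributes in
  the time direction.
\<close>
lemma prolongation1_jet1: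
  assumes "(t, x) \<in> W"
  shows "frechet_derivative jet1 (at (t, x, v)) (prolongation1 X (t, x, v)) = prolongation1 Y (jet1 (t, x, v))"
proof -
  have "prolongation1 Y (jet1 (t, x, v))
      = (rate t * fst (X (t, x)), snd (X (t, x)), prol_coeff1 Y (jet1 (t, x, v)))"
    by (simp add: prolongation1_def jet1_def Y_eq[OF assms])
  then show ?thesis
    by (simp add: frechet_derivative_at[OF has_derivative_jet1[OF time_in_I[OF assms]], symmetric]
        prolongation1_def prol_coeff1_jet1[OF assms])
qed

lemma differentiable_prol_coeff1:
  fixes Z :: "'n vfield"
  assumes "open P" "smooth_on P Z" "(t, x) \<in> P"
  shows "prol_coeff1 Z differentiable at (t, x, v)"
proof -
  have b: "(\<lambda>q. (fst q, fst (snd q))) differentiable at (t, x, v)" "(\<lambda>q. (1::real, snd (snd q))) differentiable at (t, x, v)"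
    "(\<lambda>q. snd (snd q)) differentiable at (t, x, v)" for t and x v :: "real^'n"
    by (intro bounded_linear_imp_differentiable bounded_linear_intros differentiable_Pair differentiable_const)+
  show ?thesis
    unfolding prol_coeff1_def total_deriv1_def case_prod_unfold fst_conv snd_conv
    by (intro differentiable_diff differentiable_scaleR b
        differentiable_frechet_derivative_apply[OF assms(1), where \<pi> = "\<lambda>q. (fst q, fst (snd q))"]
        smooth_on_linear[OF bounded_linear_fst] smooth_on_linear[OF bounded_linear_snd] assms(1,2))
      (simp_all add: assms(3))
qed

text \<open>
  The first coefficient of \<open>Y\<close>, read in the jet coordinates of \<open>t\<close>, is known on a whole
  neighbourhood, so its total derivative in \<open>s\<close> is the total derivative in \<open>t\<close> of that
  expression divided by the rate.
\<close>
lemma prol_coeff2_jet2: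
  assumes "(t, x) \<in> W"
  shows "prol_coeff2 Y (jet2 (t, x, v, a)) = (inverse (rate t))\<^sup>2 *\<^sub>R
    (prol_coeff2 X (t, x, v, a) + \<phi> t *\<^sub>R prol_coeff1 X (t, x, v)
      + (deriv \<phi> t * fst (X (t, x))) *\<^sub>R v + (2 * \<phi> t * fst (X (t, x))) *\<^sub>R (a + \<phi> t *\<^sub>R v))"
proof -
  note I = time_in_I[OF assms]
  let ?q = "(t, x, v)" and ?W1 = "{q. (fst q, fst (snd q)) \<in> W} :: (real \<times> (real^'n) \<times> (real^'n)) set"
  let ?\<eta>1 = "prol_coeff1 X" and ?\<xi> = "\<lambda>q. fst (X (fst q, fst (snd q)))"
  let ?h = "\<lambda>q. inverse (rate (fst q)) *\<^sub>R (?\<eta>1 q + (\<phi> (fst q) * ?\<xi> q) *\<^sub>R snd (snd q))"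
  have openW1: "open ?W1"
    using continuous_open_vimage[OF open_W, of "\<lambda>q. (fst q, fst (snd q))"]
    by (simp add: vimage_def continuous_intros)
  have e: "((\<lambda>q. inverse (rate (fst q))) has_derivative (\<lambda>h. \<phi> t * inverse (rate t) * fst h)) (at ?q)"
    using has_derivative_of_time[of "\<lambda>t. inverse (rate t)" _ ?q] DERIV_inverse_rate[OF I] by simp
  have \<phi>: "((\<lambda>q. \<phi> (fst q)) has_derivative (\<lambda>h. deriv \<phi> t * fst h)) (at ?q)"
    using has_derivative_of_time[of \<phi> _ ?q] smooth_on_real_has_derivative[OF smooth_phi I] by simp
  have v: "((\<lambda>q. snd (snd q)) has_derivative (\<lambda>h. snd (snd h))) (at ?q)"
    and p: "((\<lambda>q. (fst q, fst (snd q))) has_derivative (\<lambda>h. (fst h, fst (snd h)))) (at ?q)"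
    by (intro has_derivative_fst has_derivative_snd has_derivative_ident has_derivative_Pair)+
  have \<xi>: "(?\<xi> has_derivative (\<lambda>h. frechet_derivative (\<lambda>p. fst (X p)) (at (t, x)) (fst h, fst (snd h)))) (at ?q)"
    using has_derivative_compose[OF p, of "\<lambda>p. fst (X p)"]
      smooth_on_imp_has_derivative[OF smooth_components(1) assms] by simp
  have \<eta>1: "(?\<eta>1 has_derivative frechet_derivative ?\<eta>1 (at ?q)) (at ?q)"
    using differentiable_prol_coeff1[OF open_W smooth_X assms] by (simp add: frechet_derivative_works)
  note h = has_derivative_scaleR[OF e has_derivative_add[OF \<eta>1 has_derivative_scaleR[OF has_derivative_mult[OF \<phi> \<xi>] v]]]
  have 1: "total_deriv2 ?h (t, x, v, a) = inverse (rate t) *\<^sub>R (total_deriv2 ?\<eta>1 (t, x, v, a)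
      + (\<phi> t * fst (X (t, x))) *\<^sub>R a + (\<phi> t * total_deriv1 (\<lambda>p. fst (X p)) (t, x, v)
         + deriv \<phi> t * fst (X (t, x))) *\<^sub>R v
      + \<phi> t *\<^sub>R (?\<eta>1 (t, x, v) + (\<phi> t * fst (X (t, x))) *\<^sub>R v))"
    unfolding total_deriv2_def total_deriv1_def prod.case frechet_derivative_at[OF h, symmetric]
    by (simp add: algebra_simps)
  have 2: "total_deriv2 ?h (t, x, v, a) = rate t *\<^sub>R total_deriv2 (prol_coeff1 Y) (jet2 (t, x, v, a))"
  proof (rule total_deriv2_reparam[OF I openW1])
    show "(t, x, v) \<in> ?W1" using assms by simp
    show "?h p = prol_coeff1 Y (jet1 p)" if "p \<in> ?W1" for p
      using prol_coeff1_jet1 that by (cases p) auto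
    show "prol_coeff1 Y differentiable at (jet1 (t, x, v))"
      using differentiable_prol_coeff1[OF open_SW smooth_Y image_in_SW[OF assms]] by (simp add: jet1_def)
  qed
  have 3: "total_deriv2 (prol_coeff1 Y) (jet2 (t, x, v, a)) = inverse (rate t) *\<^sub>R total_deriv2 ?h (t, x, v, a)"
    unfolding 2 using rate_pos[OF I] by simp
  have 4: "prol_coeff2 Y (jet2 (t, x, v, a)) = total_deriv2 (prol_coeff1 Y) (jet2 (t, x, v, a))
     - total_deriv1 (\<lambda>p. fst (Y p)) (jet1 (t, x, v)) *\<^sub>R ((inverse (rate t))\<^sup>2 *\<^sub>R (a + \<phi> t *\<^sub>R v))"
    by (simp add: prol_coeff2_def jet2_def jet1_def)
  show ?thesis
    unfolding 4 3 1 total_deriv_xi[OF assms]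
    by (simp add: prol_coeff2_def power2_eq_square vec_eq_iff algebra_simps)
qed

lemma prolongation2_jet2:
  assumes "(t, x) \<in> W"
  shows "frechet_derivative jet2 (at (t, x, v, a)) (prolongation2 X (t, x, v, a)) = prolongation2 Y (jet2 (t, x, v, a))"
proof -
  have "prolongation2 Y (jet2 (t, x, v, a)) = (rate t * fst (X (t, x)), snd (X (t, x)),
      prol_coeff1 Y (jet1 (t, x, v)), prol_coeff2 Y (jet2 (t, x, v, a)))"
    by (simp add: prolongation2_def jet1_def jet2_def Y_eq[OF assms])
  then show ?thesis
    by (simp add: frechet_derivative_at[OF has_derivative_jet2[OF time_in_I[OF assms]], symmetric]
        prolongation2_def prol_coeff1_jet1[OF assms] prol_coeff2_jet2[OF assms])
qed

end

section \<open>Transport of the symmetry conditions\<close>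

context corresponding_fields
begin

text \<open>
  The factor \<open>(rate t)\<^sup>2\<close> also depends on \<open>t\<close>, but in the product rule its derivative multiplies
  \<open>E\<close>, which vanishes at the point. Hence invariance is compared only on solutions.
\<close>
lemma apply_prolongation2:
  fixes E E' :: "'n system"
  assumes "(t, x) \<in> W" and "E differentiable at (jet2 (t, x, v, a))"
    and E': "\<And>t x v a. t \<in> I \<Longrightarrow> E' (t, x, v, a) = (rate t)\<^sup>2 *\<^sub>R E (jet2 (t, x, v, a))"
    and zero: "E' (t, x, v, a) = 0"
  shows "apply_vfield (prolongation2 X) E' (t, x, v, a)
    = (rate t)\<^sup>2 *\<^sub>R apply_vfield (prolongation2 Y) E (jet2 (t, x, v, a))"
proof -
  note I = time_in_I[OF assms(1)]
  let ?p = "(t, x, v, a)" and ?E = "frechet_derivative E (at (jet2 (t, x, v, a)))"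
  let ?J = "frechet_derivative jet2 (at ?p)"
  have r: "((\<lambda>p. (rate (fst p))\<^sup>2) has_derivative (\<lambda>k. (2 * rate t * (- \<phi> t * rate t)) * fst k)) (at ?p)"
  proof (rule has_derivative_of_time)
    show "((\<lambda>t. (rate t)\<^sup>2) has_real_derivative 2 * rate t * (- \<phi> t * rate t)) (at (fst ?p))"
      using DERIV_power[OF DERIV_rate[OF I], of 2] by (simp add: mult_ac)
  qed
  have J: "(jet2 has_derivative ?J) (at ?p)"
    using has_derivative_jet2[OF I, of v a x] by (simp add: frechet_derivative_at[symmetric])
  have EJ: "((\<lambda>p. E (jet2 p)) has_derivative (\<lambda>k. ?E (?J k))) (at ?p)"
    using has_derivative_compose[OF J] assms(2) by (simp add: frechet_derivative_works)
  have E0: "E (jet2 ?p) = 0"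
    using zero E'[OF I] rate_pos[OF I] by simp
  have "((\<lambda>p. (rate (fst p))\<^sup>2 *\<^sub>R E (jet2 p)) has_derivative (\<lambda>k. (rate t)\<^sup>2 *\<^sub>R ?E (?J k))) (at ?p)"
    using has_derivative_scaleR[OF r EJ] E0 by simp
  then have "(E' has_derivative (\<lambda>k. (rate t)\<^sup>2 *\<^sub>R ?E (?J k))) (at ?p)"
    by (rule has_derivative_transform_within_open[where s = "I \<times> UNIV"])
      (use I E' in \<open>auto intro: open_Times open_I\<close>)
  from frechet_derivative_at[OF this, symmetric] show ?thesis
    by (simp only: apply_vfield_def prolongation2_jet2[OF assms(1)])
qed

text \<open>
  No equation holds here, so the derivative of the factor \<open>rate t\<close> survives as
  \<open>-\<phi> \<xi> (rate t) L\<close>. It cancels against the correction in \<open>total_deriv_xi\<close>, which is why the Noether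
  condition contains the term with the total derivative of \<open>\<xi>\<close>.
\<close>
lemma apply_prolongation1:
  fixes L L' :: "real \<times> (real^'n) \<times> (real^'n) \<Rightarrow> real"
  assumes "(t, x) \<in> W" and "L differentiable at (jet1 (t, x, v))"
    and L': "\<And>t x v. t \<in> I \<Longrightarrow> L' (t, x, v) = rate t * L (jet1 (t, x, v))"
  shows "apply_vfield (prolongation1 X) L' (t, x, v)
      + total_deriv1 (\<lambda>p. fst (X p)) (t, x, v) * L' (t, x, v)
    = rate t * (apply_vfield (prolongation1 Y) L (jet1 (t, x, v))
      + total_deriv1 (\<lambda>p. fst (Y p)) (jet1 (t, x, v)) * L (jet1 (t, x, v)))"
proof -
  note I = time_in_I[OF assms(1)]
  let ?p = "(t, x, v)" and ?L = "frechet_derivative L (at (jet1 (t, x, v)))"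
  let ?J = "frechet_derivative jet1 (at ?p)"
  have r: "((\<lambda>p. rate (fst p)) has_derivative (\<lambda>k. (- \<phi> t * rate t) * fst k)) (at ?p)"
    by (rule has_derivative_of_time) (use DERIV_rate[OF I] in simp)
  have J: "(jet1 has_derivative ?J) (at ?p)"
    using has_derivative_jet1[OF I, of v x] by (simp add: frechet_derivative_at[symmetric])
  have LJ: "((\<lambda>p. L (jet1 p)) has_derivative (\<lambda>k. ?L (?J k))) (at ?p)"
    using has_derivative_compose[OF J] assms(2) by (simp add: frechet_derivative_works)
  have "(L' has_derivative (\<lambda>k. rate (fst ?p) * ?L (?J k) + (- \<phi> t * rate t) * fst k * L (jet1 ?p))) (at ?p)"
    by (rule has_derivative_transform_within_open[OF has_derivative_mult[OF r LJ], where s = "I \<times> UNIV"])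
      (use I L' in \<open>auto intro: open_Times open_I\<close>)
  from frechet_derivative_at[OF this, symmetric]
  have "apply_vfield (prolongation1 X) L' ?p = rate t * apply_vfield (prolongation1 Y) L (jet1 ?p)
      - \<phi> t * rate t * fst (X (t, x)) * L (jet1 ?p)"
    unfolding apply_vfield_def by (simp add: prolongation1_jet1[OF assms(1)]) (simp add: prolongation1_def)
  then show ?thesis
    unfolding total_deriv_xi[OF assms(1)] L'[OF I] by (simp add: algebra_simps)
qed

lemma lie_point_symmetry_iff:
  assumes "\<And>t x v a. (t, x) \<in> W \<Longrightarrow> E differentiable at (jet2 (t, x, v, a))"
    and E': "\<And>t x v a. t \<in> I \<Longrightarrow> E' (t, x, v, a) = (rate t)\<^sup>2 *\<^sub>R E (jet2 (t, x, v, a))"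
  shows "lie_point_symmetry_on E' W X \<longleftrightarrow> lie_point_symmetry_on E (change_param S ` W) Y"
proof -
  have zero: "E' (t, x, v, a) = 0 \<longleftrightarrow> E (jet2 (t, x, v, a)) = 0" if "(t, x) \<in> W" for t x v a
    using E' rate_pos time_in_I[OF that] by fastforce
  have inv: "apply_vfield (prolongation2 X) E' (t, x, v, a) = 0
      \<longleftrightarrow> apply_vfield (prolongation2 Y) E (jet2 (t, x, v, a)) = 0"
    if "(t, x) \<in> W" "E' (t, x, v, a) = 0" for t x v a
    using apply_prolongation2[OF that(1) assms(1)[OF that(1)] E' that(2)] rate_pos[OF time_in_I[OF that(1)]] by simp
  have surj: "\<exists>t v a. (t, x) \<in> W \<and> (s, x, w, b) = jet2 (t, x, v, a)"
    if sx: "(s, x) \<in> change_param S ` W" for s x w b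
  proof -
    from sx obtain t where t: "(t, x) \<in> W" "s = S t" by (auto simp: change_param_def)
    \<comment> \<open>The arguments solve \<open>w = v / rate t\<close> and \<open>b = (a + \<phi> v) / (rate t)\<^sup>2\<close> for \<open>v\<close> and \<open>a\<close>.\<close>
    have "(s, x, w, b) = jet2 (t, x, rate t *\<^sub>R w, (rate t)\<^sup>2 *\<^sub>R b - \<phi> t *\<^sub>R (rate t *\<^sub>R w))"
      using rate_pos[OF time_in_I[OF t(1)]] t(2) by (simp add: jet2_def power_inverse)
    with t(1) show ?thesis by blast
  qed
  have mem: "(s, x) \<in> change_param S ` W" if "(t, x') \<in> W" "(s, x, w, b) = jet2 (t, x', v, a)" for s x w b t x' v a
    using that image_in_SW by (simp add: jet2_def)
  show ?thesis
    unfolding lie_point_symmetry_on_def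
  proof (intro conj_cong)
    show "smooth_on W X = smooth_on (change_param S ` W) Y" using smooth_X smooth_Y by simp
    show "(\<forall>t x v a. (t, x) \<in> W \<and> E' (t, x, v, a) = 0 \<longrightarrow> apply_vfield (prolongation2 X) E' (t, x, v, a) = 0) \<longleftrightarrow>
      (\<forall>s x w b. (s, x) \<in> change_param S ` W \<and> E (s, x, w, b) = 0 \<longrightarrow>
         apply_vfield (prolongation2 Y) E (s, x, w, b) = 0)" (is "?A \<longleftrightarrow> ?B")
    proof
      assume A: ?A
      show ?B
      proof (intro allI impI)
        fix s x w b assume sx: "(s, x) \<in> change_param S ` W \<and> E (s, x, w, b) = 0"
        then obtain t v a where t: "(t, x) \<in> W" and j: "(s, x, w, b) = jet2 (t, x, v, a)"
          using surj by blast
        have "E' (t, x, v, a) = 0" using sx zero[OF t] unfolding j by simp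
        then show "apply_vfield (prolongation2 Y) E (s, x, w, b) = 0"
          using A t inv[OF t] unfolding j by simp
      qed
    next
      assume B: ?B
      show ?A
      proof (intro allI impI)
        fix t x v a assume tx: "(t, x) \<in> W \<and> E' (t, x, v, a) = 0"
        obtain s x' w b where j: "(s, x', w, b) = jet2 (t, x, v, a)" by (cases "jet2 (t, x, v, a)") auto
        have "E (s, x', w, b) = 0" using tx zero[of t x v a] unfolding j by blast
        then have "apply_vfield (prolongation2 Y) E (s, x', w, b) = 0"
          using B mem[OF _ j] tx by blast
        then show "apply_vfield (prolongation2 X) E' (t, x, v, a) = 0"
          using inv[of t x v a] tx unfolding j by blast
      qed
    qed
  qed
qed

lemma noether_point_symmetry_iff:
  assumes "\<And>t x v. (t, x) \<in> W \<Longrightarrow> L differentiable at (jet1 (t, x, v))"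
    and L': "\<And>t x v. t \<in> I \<Longrightarrow> L' (t, x, v) = rate t * L (jet1 (t, x, v))"
  shows "noether_point_symmetry_on L' W X \<longleftrightarrow> noether_point_symmetry_on L (change_param S ` W) Y"
proof -
  define N where "N L X f = (\<lambda>(t, x, v). apply_vfield (prolongation1 X) L (t, x, v)
    + total_deriv1 (\<lambda>p. fst (X p)) (t, x, v) * L (t, x, v) = total_deriv1 f (t, x, v))"
    for L :: "real \<times> (real^'n) \<times> (real^'n) \<Rightarrow> real" and X :: "'n vfield" and f
  have key: "N L' X f (t, x, v) \<longleftrightarrow> N L Y h (jet1 (t, x, v))"
    if "smooth_on (change_param S ` W) h" "\<forall>p\<in>W. f p = h (change_param S p)" "(t, x) \<in> W"
    for f h t x v
  proof -
    note I = time_in_I[OF that(3)]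
    have "total_deriv1 f (t, x, v) = rate t * total_deriv1 h (jet1 (t, x, v))"
      using total_deriv1_reparam[OF I open_W that(3) that(2)[rule_format]
          smooth_on_imp_has_derivative[OF that(1) image_in_SW[OF that(3)]]] by simp
    then show ?thesis
      using apply_prolongation1[OF that(3) assms(1)[OF that(3)] L'] rate_pos[OF I]
      by (simp add: N_def case_prod_unfold)
  qed
  have surj: "\<exists>t v. (t, x) \<in> W \<and> (s, x, w) = jet1 (t, x, v)"
    if sx: "(s, x) \<in> change_param S ` W" for s x w
  proof -
    from sx obtain t where t: "(t, x) \<in> W" "s = S t" by (auto simp: change_param_def)
    have "(s, x, w) = jet1 (t, x, rate t *\<^sub>R w)"
      using rate_pos[OF time_in_I[OF t(1)]] t(2) by (simp add: jet1_def)
    with t(1) show ?thesis by blast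
  qed
  have all: "(\<forall>t x v. (t, x) \<in> W \<longrightarrow> N L' X f (t, x, v)) \<longleftrightarrow>
      (\<forall>s x w. (s, x) \<in> change_param S ` W \<longrightarrow> N L Y h (s, x, w))"
    if "smooth_on (change_param S ` W) h" "\<forall>p\<in>W. f p = h (change_param S p)" for f h
  proof (intro iffI allI impI)
    fix s x w assume A: "\<forall>t x v. (t, x) \<in> W \<longrightarrow> N L' X f (t, x, v)" and "(s, x) \<in> change_param S ` W"
    then obtain t v where t: "(t, x) \<in> W" and j: "(s, x, w) = jet1 (t, x, v)" using surj by blast
    show "N L Y h (s, x, w)" unfolding j using key[OF that t, of v] A t by blast
  next
    fix t x v assume B: "\<forall>s x w. (s, x) \<in> change_param S ` W \<longrightarrow> N L Y h (s, x, w)" and t: "(t, x) \<in> W"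
    have "N L Y h (jet1 (t, x, v))" using B image_in_SW[OF t] unfolding jet1_def prod.case by blast
    then show "N L' X f (t, x, v)" using key[OF that t, of v] by blast
  qed
  have "(\<exists>f. smooth_on W f \<and> (\<forall>t x v. (t, x) \<in> W \<longrightarrow> N L' X f (t, x, v))) \<longleftrightarrow>
      (\<exists>h. smooth_on (change_param S ` W) h \<and> (\<forall>s x w. (s, x) \<in> change_param S ` W \<longrightarrow> N L Y h (s, x, w)))"
  proof (intro iffI; elim exE conjE)
    fix f assume f: "smooth_on W f" "\<forall>t x v. (t, x) \<in> W \<longrightarrow> N L' X f (t, x, v)"
    note h = smooth_on_reparam_inverse[OF open_W W_I f(1)]
    have "\<forall>p\<in>W. f p = f (change_param T (change_param S p))"
      using change_param_inverse W_I by (metis subsetD)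
    from all[OF h this] h f(2)
    show "\<exists>h. smooth_on (change_param S ` W) h \<and> (\<forall>s x w. (s, x) \<in> change_param S ` W \<longrightarrow> N L Y h (s, x, w))"
      by blast
  next
    fix h assume h: "smooth_on (change_param S ` W) h" "\<forall>s x w. (s, x) \<in> change_param S ` W \<longrightarrow> N L Y h (s, x, w)"
    from all[OF h(1) ballI[OF refl]] h(2) smooth_on_reparam[OF open_W W_I h(1)]
    show "\<exists>f. smooth_on W f \<and> (\<forall>t x v. (t, x) \<in> W \<longrightarrow> N L' X f (t, x, v))" by blast
  qed
  then show ?thesis
    using smooth_X smooth_Y unfolding noether_point_symmetry_on_def N_def by simp
qed

end

context damping_clock
begin

lemma pushforward_eq_iff:
  fixes X Y :: "('n::finite) vfield"
  assumes "t \<in> I"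
  shows "X (t, x) = pushforward (change_param T) (change_param S) Y (t, x) \<longleftrightarrow>
    Y (S t, x) = (rate t * fst (X (t, x)), snd (X (t, x)))"
  using pushforward_change_param[OF DERIV_T[OF assms], of "change_param S" "(t, x)" x Y] rate_pos[OF assms]
  by (auto simp: change_param_def prod_eq_iff field_simps)

text \<open>
  The part common to Lie and Noether symmetries. One direction has to construct \<open>Y\<close> from \<open>X\<close>,
  which uses smoothness of \<open>rate\<close> and of \<open>T\<close>; the other has to derive smoothness of \<open>X\<close> from that
  of \<open>Y\<close>.
\<close>
lemma symmetry_correspondence:
  fixes W :: "(real \<times> (real^'n)) set" and P Q :: "('n::finite) vfield \<Rightarrow> bool"
  assumes "open W" "W \<subseteq> I \<times> UNIV"
    and "\<And>X. P X \<Longrightarrow> smooth_on W X" and "\<And>Y. Q Y \<Longrightarrow> smooth_on (change_param S ` W) Y"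
    and "\<And>X Y. corresponding_fields I \<phi> S T W X Y \<Longrightarrow> P X \<longleftrightarrow> Q Y"
  shows "P X \<longleftrightarrow> (\<exists>Y. Q Y \<and> (\<forall>p\<in>W. X p = pushforward (change_param T) (change_param S) Y p))"
proof -
  have corr: "corresponding_fields I \<phi> S T W X Y"
    if "smooth_on W X" "smooth_on (change_param S ` W) Y"
      "\<forall>p\<in>W. X p = pushforward (change_param T) (change_param S) Y p" for Y
  proof
    show "Y (S t, x) = (rate t * fst (X (t, x)), snd (X (t, x)))" if "(t, x) \<in> W" for t x
      using pushforward_eq_iff[of t X x Y] that \<open>\<forall>p\<in>W. _\<close> assms(2) by auto
  qed (use assms that in auto)
  show ?thesis
  proof
    assume P: "P X"
    then have X: "smooth_on W X" by (rule assms(3))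
    define Y where "Y q = (rate (fst (change_param T q)) * fst (X (change_param T q)), snd (X (change_param T q)))" for q
    have fst: "smooth_on W fst"
      unfolding smooth_on_def using assms(1) times_differentiable_on_bounded_linear[OF bounded_linear_fst] by blast
    have "smooth_on W (\<lambda>p. rate (fst p))"
      by (rule smooth_on_compose[OF assms(1) open_I _ smooth_rate fst]) (use assms(2) in auto)
    then have "smooth_on W (\<lambda>p. (rate (fst p) * fst (X p), snd (X p)))"
      by (intro smooth_on_Pair smooth_on_mult smooth_on_linear[OF bounded_linear_fst]
          smooth_on_linear[OF bounded_linear_snd] assms(1) X)
    from smooth_on_reparam_inverse[OF assms(1,2) this] have Y: "smooth_on (change_param S ` W) Y"
      unfolding Y_def .
    have "X (t, x) = pushforward (change_param T) (change_param S) Y (t, x)" if "(t, x) \<in> W" for t x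
      using pushforward_eq_iff[of t X x Y] that assms(2) by (auto simp: Y_def change_param_def inverse_S)
    then have r: "\<forall>p\<in>W. X p = pushforward (change_param T) (change_param S) Y p" by auto
    with P assms(5)[OF corr[OF X Y r]]
    show "\<exists>Y. Q Y \<and> (\<forall>p\<in>W. X p = pushforward (change_param T) (change_param S) Y p)" by blast
  next
    assume "\<exists>Y. Q Y \<and> (\<forall>p\<in>W. X p = pushforward (change_param T) (change_param S) Y p)"
    then obtain Y where Q: "Q Y" and r: "\<forall>p\<in>W. X p = pushforward (change_param T) (change_param S) Y p" by blast
    have Y: "smooth_on (change_param S ` W) Y" by (rule assms(4)[OF Q])
    have "smooth_on (S ` I) (\<lambda>s. frechet_derivative T (at s) 1)"
      by (rule smooth_on_frechet_derivative[OF smooth_T])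
    then have dT: "smooth_on (S ` I) (deriv T)"
    proof (rule smooth_on_cong[OF open_image_S[OF open_I order_refl], rotated])
      fix s assume "s \<in> S ` I"
      then have "(T has_derivative (\<lambda>h. deriv T s * h)) (at s)"
        using smooth_on_real_has_derivative[OF smooth_T] by (simp add: has_field_derivative_def)
      from frechet_derivative_at[OF this, symmetric] show "frechet_derivative T (at s) 1 = deriv T s" by simp
    qed
    have op: "open (change_param S ` W)" by (rule open_image_change_param[OF assms(1,2)])
    have fst: "smooth_on (change_param S ` W) fst"
      unfolding smooth_on_def using op times_differentiable_on_bounded_linear[OF bounded_linear_fst] by blast
    have "smooth_on (change_param S ` W) (\<lambda>q. deriv T (fst q))"
      by (rule smooth_on_compose[OF op open_image_S[OF open_I order_refl] _ dT fst])
        (use assms(2) in \<open>auto simp: change_param_def\<close>)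
    then have "smooth_on (change_param S ` W) (\<lambda>q. (deriv T (fst q) * fst (Y q), snd (Y q)))"
      by (intro smooth_on_Pair smooth_on_mult smooth_on_linear[OF bounded_linear_fst]
          smooth_on_linear[OF bounded_linear_snd] op Y)
    from smooth_on_reparam[OF assms(1,2) this] have X: "smooth_on W X"
    proof (rule smooth_on_cong[OF assms(1), rotated])
      fix p assume p: "p \<in> W"
      obtain t x where tx: "p = (t, x)" by (cases p)
      with p assms(2) have "t \<in> I" by auto
      then show "(deriv T (fst (change_param S p)) * fst (Y (change_param S p)), snd (Y (change_param S p))) = X p"
        using pushforward_change_param[OF DERIV_T, of t "change_param S" p x Y] r p DERIV_imp_deriv[OF DERIV_T]
        by (simp add: tx change_param_def)
    qed
    show "P X" using assms(5)[OF corr[OF X Y r]] Q by blast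
  qed
qed

end

section \<open>Differentiability of the geodesic terms\<close>

lemma differentiable_vecI:
  fixes f :: "'a::real_normed_vector \<Rightarrow> real^'n"
  assumes "\<And>i. (\<lambda>q. f q $ i) differentiable at q"
  shows "f differentiable at q"
  by (subst differentiable_componentwise_within) (use assms in \<open>auto simp: Basis_vec_def inner_axis\<close>)

lemma differentiable_prod:
  fixes f :: "'i \<Rightarrow> 'a::real_normed_vector \<Rightarrow> real"
  assumes "\<And>i. i \<in> A \<Longrightarrow> f i differentiable at q"
  shows "(\<lambda>q. \<Prod>i\<in>A. f i q) differentiable at q"
  using assms by (induction A rule: infinite_finite_induct) (auto intro: differentiable_mult)

lemma differentiable_det:
  fixes A :: "'a::real_normed_vector \<Rightarrow> real^'n^'n"
  assumes "\<And>i j. (\<lambda>q. A q $ i $ j) differentiable at q"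
  shows "(\<lambda>q. det (A q)) differentiable at q"
proof -
  have "(\<lambda>q. \<Prod>i\<in>UNIV. A q $ i $ p i) differentiable at q" for p
    by (rule differentiable_prod) (rule assms)
  then show ?thesis
    unfolding det_def
    by (intro differentiable_sum differentiable_mult differentiable_const) (auto simp: finite_permutations)
qed

text \<open>
  Cramer's rule for the columns of the inverse. It presents the entries as quotients of
  polynomials in the entries of the matrix, whence their differentiability.
\<close>
lemma matrix_inv_entry:
  fixes A :: "real^'n^'n"
  assumes "invertible A"
  shows "matrix_inv A $ i $ j = det (\<chi> r c. if c = i then axis j 1 $ r else A $ r $ c) / det A"
proof -
  have "A *v (matrix_inv A *v axis j 1) = axis j 1"
    using assms someI_ex[of "\<lambda>B. A ** B = mat 1 \<and> B ** A = mat 1"]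
    by (simp add: matrix_vector_mul_assoc matrix_inv_def invertible_def)
  then have "matrix_inv A *v axis j 1 = (\<chi> i. det (\<chi> r c. if c = i then axis j 1 $ r else A $ r $ c) / det A)"
    using assms cramer[of A] by (simp add: invertible_det_nz)
  moreover have "(matrix_inv A *v axis j 1) $ i = matrix_inv A $ i $ j"
    by (simp add: matrix_vector_mult_basis column_def)
  ultimately show ?thesis by simp
qed

lemma differentiable_matrix_inv_entry:
  fixes A :: "'a::real_normed_vector \<Rightarrow> real^'n^'n"
  assumes "open U" "x \<in> U" "\<And>y. y \<in> U \<Longrightarrow> invertible (A y)"
    and "\<And>i j. (\<lambda>y. A y $ i $ j) differentiable at x"
  shows "(\<lambda>y. matrix_inv (A y) $ i $ j) differentiable at x"
proof -
  let ?f = "\<lambda>y. det (\<chi> r c. if c = i then axis j 1 $ r else A y $ r $ c) / det (A y)"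
  have "(\<lambda>y. if c = i then axis j 1 $ r else A y $ r $ c) differentiable at x" for r c
    using assms(4) by (cases "c = i") auto
  then have "?f differentiable at x"
    using assms(3)[OF assms(2)]
    by (intro differentiable_divide differentiable_det assms(4)) (auto simp: invertible_det_nz)
  then obtain f' where "(?f has_derivative f') (at x)" by (auto simp: differentiable_def)
  then have "((\<lambda>y. matrix_inv (A y) $ i $ j) has_derivative f') (at x)"
    by (rule has_derivative_transform_within_open[OF _ assms(1,2)]) (simp add: matrix_inv_entry assms(3))
  then show ?thesis by (auto simp: differentiable_def)
qed

lemma positive_definite_invertible:
  fixes A :: "real^'n^'n"
  assumes "\<And>v. v \<noteq> 0 \<Longrightarrow> v \<bullet> (A *v v) > 0"
  shows "invertible A"
proof -
  have "\<forall>v. A *v v = 0 \<longrightarrow> v = 0" using assms by (metis inner_zero_right less_irrefl)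
  then show ?thesis by (simp add: invertible_left_inverse matrix_left_invertible_ker)
qed

lemma smooth_on_differentiable: "smooth_on U f \<Longrightarrow> x \<in> U \<Longrightarrow> f differentiable at x"
  using smooth_on_imp_has_derivative differentiable_def by blast

lemma differentiable_pderiv_coord:
  "smooth_on U f \<Longrightarrow> x \<in> U \<Longrightarrow> (\<lambda>y. pderiv_coord i f y) differentiable at x"
  unfolding pderiv_coord_def by (intro smooth_on_differentiable smooth_on_frechet_derivative)

locale riemannian_chart =
  fixes U :: "(real^'n) set" and g :: "real^'n \<Rightarrow> real^'n^'n" and V :: "real^'n \<Rightarrow> real"
  assumes open_U: "open U" and metric: "riemannian_metric_on U g" and smooth_V: "smooth_on U V"
begin

lemma smooth_metric_entry: "smooth_on U (\<lambda>x. g x $ i $ j)"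
  using metric unfolding riemannian_metric_on_def
  by (intro smooth_on_linear[OF bounded_linear_vec_nth open_U]) auto

lemma differentiable_inverse_metric:
  assumes "x \<in> U"
  shows "(\<lambda>y. matrix_inv (g y) $ i $ j) differentiable at x"
  by (rule differentiable_matrix_inv_entry[OF open_U assms])
    (use metric smooth_on_differentiable[OF smooth_metric_entry assms] in
      \<open>auto simp: riemannian_metric_on_def intro: positive_definite_invertible\<close>)

lemma differentiable_christoffel:
  assumes "x \<in> U"
  shows "(\<lambda>y. christoffel g y i j k) differentiable at x"
  unfolding christoffel_def
  by (intro differentiable_mult differentiable_sum ballI differentiable_add differentiable_diff differentiable_const
      differentiable_inverse_metric differentiable_pderiv_coord[OF smooth_metric_entry] assms finite)

lemma differentiable_metric_gradient:
  assumes "x \<in> U"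
  shows "metric_gradient g V differentiable at x"
  unfolding metric_gradient_def
  by (rule differentiable_vecI, simp only: vec_lambda_beta)
    (intro differentiable_sum ballI differentiable_mult differentiable_inverse_metric
      differentiable_pderiv_coord[OF smooth_V] assms finite)

lemma differentiable_timedep_system:
  assumes "x \<in> U" "\<omega> differentiable at s"
  shows "timedep_system g V \<omega> differentiable at (s, x, v, a)"
proof -
  let ?q = "(s, x, v, a)"
  have pr: "fst differentiable at ?q" "(\<lambda>q. fst (snd q)) differentiable at ?q"
    "(\<lambda>q. fst (snd (snd q))) differentiable at ?q" "(\<lambda>q. snd (snd (snd q))) differentiable at ?q"
    by (intro bounded_linear_imp_differentiable bounded_linear_intros bounded_linear_fst)+
  have x: "(\<lambda>q. h (fst (snd q))) differentiable at ?q" if "h differentiable at x"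
    for h :: "real^'n \<Rightarrow> 'b::real_normed_vector"
    using differentiable_chain_at[OF pr(2), of h] that by (simp add: o_def)
  have \<omega>: "(\<lambda>q. \<omega> (fst q)) differentiable at ?q"
    using differentiable_chain_at[OF pr(1), of \<omega>] assms(2) by (simp add: o_def)
  have v: "(\<lambda>q. fst (snd (snd q)) $ j) differentiable at ?q" for j
    by (intro bounded_linear_imp_differentiable bounded_linear_compose[OF bounded_linear_vec_nth] bounded_linear_intros)
  have "(\<lambda>q. connection_term g (fst (snd q)) (fst (snd (snd q)))) differentiable at ?q"
    unfolding connection_term_def
    by (rule differentiable_vecI, simp only: vec_lambda_beta)
      (intro differentiable_sum ballI differentiable_mult v x differentiable_christoffel assms finite)
  then show ?thesis
    unfolding timedep_system_def case_prod_unfold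
    by (intro differentiable_add differentiable_scaleR pr \<omega> x differentiable_metric_gradient assms)
qed

lemma differentiable_timedep_lagrangian:
  assumes "x \<in> U" "\<omega> differentiable at s"
  shows "timedep_lagrangian g V \<omega> differentiable at (s, x, v)"
proof -
  let ?q = "(s, x, v)"
  have pr: "fst differentiable at ?q" "(\<lambda>q. fst (snd q)) differentiable at ?q"
    by (intro bounded_linear_imp_differentiable bounded_linear_intros bounded_linear_fst)+
  have x: "(\<lambda>q. h (fst (snd q))) differentiable at ?q" if "h differentiable at x"
    for h :: "real^'n \<Rightarrow> 'b::real_normed_vector"
    using differentiable_chain_at[OF pr(2), of h] that by (simp add: o_def)
  have \<omega>: "(\<lambda>q. \<omega> (fst q)) differentiable at ?q"
    using differentiable_chain_at[OF pr(1), of \<omega>] assms(2) by (simp add: o_def)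
  have v: "(\<lambda>q. snd (snd q) $ j) differentiable at ?q" for j
    by (intro bounded_linear_imp_differentiable bounded_linear_compose[OF bounded_linear_vec_nth] bounded_linear_intros)
  show ?thesis
    unfolding timedep_lagrangian_def case_prod_unfold
    by (intro differentiable_diff differentiable_mult differentiable_const differentiable_sum ballI v \<omega>
        x[OF smooth_on_differentiable[OF smooth_metric_entry]] x[OF smooth_on_differentiable[OF smooth_V]] assms finite)
qed

end

section \<open>The transformed system and its solutions\<close>

lemma connection_term_scaleR: "connection_term g x (c *\<^sub>R v) = c\<^sup>2 *\<^sub>R connection_term g x v"
  by (simp add: connection_term_def vec_eq_iff sum_distrib_left power2_eq_square algebra_simps)

context damping_clock
begin

text \<open>
  The damping term is absorbed by the acceleration component of \<open>jet2\<close>, and all other terms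
  scale by \<open>(rate t)\<^sup>2\<close>.
\<close>
lemma damped_system_jet2:
  assumes "t \<in> I" "\<omega> (S t) = (inverse (rate t))\<^sup>2"
  shows "damped_system g V \<phi> (t, x, v, a) = (rate t)\<^sup>2 *\<^sub>R timedep_system g V \<omega> (jet2 (t, x, v, a))"
proof -
  have "(rate t)\<^sup>2 * (inverse (rate t))\<^sup>2 = 1"
    using rate_pos[OF assms(1)] by (simp add: power_inverse)
  then show ?thesis
    by (simp add: damped_system_def timedep_system_def jet2_def assms(2) connection_term_scaleR scaleR_add_right)
qed

text \<open>On the open image of \<open>S\<close> the function \<open>\<omega>\<close> is the square of \<open>1 / rate (T s)\<close>.\<close>
lemma differentiable_omega:
  assumes "\<forall>s\<in>S ` I. \<omega> s = (deriv T s)\<^sup>2" "t \<in> I"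
  shows "\<omega> differentiable at (S t)"
proof -
  obtain d where d: "((\<lambda>t. (inverse (rate t))\<^sup>2) has_real_derivative d) (at t)"
    using DERIV_power[OF DERIV_inverse_rate[OF assms(2)]] by blast
  have "((\<lambda>s. (inverse (rate (T s)))\<^sup>2) has_real_derivative d * inverse (rate t)) (at (S t))"
    by (rule DERIV_chain2[OF _ DERIV_T[OF assms(2)]]) (use d in \<open>simp only: inverse_S[OF assms(2)]\<close>)
  then have "(\<omega> has_real_derivative d * inverse (rate t)) (at (S t))"
    by (rule has_field_derivative_transform_within_open[OF _ open_image_S[OF open_I order_refl]])
      (use assms DERIV_imp_deriv[OF DERIV_T] inverse_S in auto)
  then show ?thesis by (auto simp: has_field_derivative_def differentiable_def)
qed

text \<open>
  Along a curve the jet map turns the derivatives with respect to \<open>t\<close> into those with respect to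
  \<open>s\<close>; the witnesses are its velocity and acceleration components and their inverses.
\<close>
lemma solves_on_reparam_iff:
  fixes E E' :: "('n::finite) system" and x y :: "real \<Rightarrow> real^'n"
  assumes E': "\<And>t x v a. t \<in> I \<Longrightarrow> E' (t, x, v, a) = (rate t)\<^sup>2 *\<^sub>R E (jet2 (t, x, v, a))"
    and J: "open J" "J \<subseteq> I" and xy: "\<And>t. t \<in> J \<Longrightarrow> y (S t) = x t"
  shows "solves_on E' U J x \<longleftrightarrow> solves_on E U (S ` J) y"
proof
  assume "solves_on E' U J x"
  then obtain v a where sol: "\<And>t. t \<in> J \<Longrightarrow> x t \<in> U \<and> (x has_vector_derivative v t) (at t) \<and>
      (v has_vector_derivative a t) (at t) \<and> E' (t, x t, v t, a t) = 0"
    unfolding solves_on_def by blast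
  define w where "w t = inverse (rate t) *\<^sub>R v t" for t
  define b where "b t = (inverse (rate t))\<^sup>2 *\<^sub>R (a t + \<phi> t *\<^sub>R v t)" for t
  have sol': "y (S t) \<in> U \<and> (y has_vector_derivative w (T (S t))) (at (S t)) \<and>
      ((\<lambda>s. w (T s)) has_vector_derivative b (T (S t))) (at (S t)) \<and>
      E (S t, y (S t), w (T (S t)), b (T (S t))) = 0" if t: "t \<in> J" for t
  proof -
    have tI: "t \<in> I" using t J(2) by blast
    note TS = inverse_S[OF tI]
    have T: "(T has_vector_derivative inverse (rate t)) (at (S t))"
      using DERIV_T[OF tI] by (simp add: has_real_derivative_iff_has_vector_derivative)
    have chain: "((\<lambda>s. z (T s)) has_vector_derivative inverse (rate t) *\<^sub>R z') (at (S t))"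
      if "(z has_vector_derivative z') (at t)" for z :: "real \<Rightarrow> real^'n" and z'
      using vector_diff_chain_at[OF T, of z z'] that by (simp add: TS o_def)
    have "(y has_vector_derivative w t) (at (S t))"
      unfolding w_def
      by (rule has_vector_derivative_transform_within_open[OF chain open_image_S[OF J]])
        (use sol t xy J(2) inverse_S in auto)
    moreover have "(w has_vector_derivative inverse (rate t) *\<^sub>R a t + (\<phi> t * inverse (rate t)) *\<^sub>R v t) (at t)"
      unfolding w_def by (rule has_vector_derivative_scaleR[OF DERIV_inverse_rate[OF tI]]) (use sol t in auto)
    from chain[OF this] have "((\<lambda>s. w (T s)) has_vector_derivative b t) (at (S t))"
      by (simp add: b_def power2_eq_square algebra_simps)
    moreover have "E (S t, y (S t), w t, b t) = 0"
      using sol[OF t] E'[OF tI] rate_pos[OF tI] xy[OF t] by (simp add: jet2_def w_def b_def)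
    ultimately show ?thesis using sol[OF t] xy[OF t] by (simp add: TS)
  qed
  show "solves_on E U (S ` J) y"
    unfolding solves_on_def
    by (intro exI[of _ "\<lambda>s. w (T s)"] exI[of _ "\<lambda>s. b (T s)"] ballI, elim imageE, hypsubst, rule sol')
next
  assume "solves_on E U (S ` J) y"
  then obtain w b where sol: "\<And>t. t \<in> J \<Longrightarrow> y (S t) \<in> U \<and> (y has_vector_derivative w (S t)) (at (S t)) \<and>
      (w has_vector_derivative b (S t)) (at (S t)) \<and> E (S t, y (S t), w (S t), b (S t)) = 0"
    unfolding solves_on_def by blast
  define v where "v t = rate t *\<^sub>R w (S t)" for t
  define a where "a t = (rate t)\<^sup>2 *\<^sub>R b (S t) - \<phi> t *\<^sub>R v t" for t
  have sol': "x t \<in> U \<and> (x has_vector_derivative v t) (at t) \<and> (v has_vector_derivative a t) (at t) \<and>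
      E' (t, x t, v t, a t) = 0" if t: "t \<in> J" for t
  proof -
    have tI: "t \<in> I" using t J(2) by blast
    have S: "(S has_vector_derivative rate t) (at t)"
      using DERIV_S[OF tI] by (simp add: has_real_derivative_iff_has_vector_derivative)
    have chain: "((\<lambda>t. z (S t)) has_vector_derivative rate t *\<^sub>R z') (at t)"
      if "(z has_vector_derivative z') (at (S t))" for z :: "real \<Rightarrow> real^'n" and z'
      using vector_diff_chain_at[OF S, of z z'] that by (simp add: o_def)
    have "(x has_vector_derivative v t) (at t)"
      unfolding v_def
      by (rule has_vector_derivative_transform_within_open[OF chain J(1) t]) (use sol t xy in auto)
    moreover have "(v has_vector_derivative rate t *\<^sub>R (rate t *\<^sub>R b (S t)) + (- \<phi> t * rate t) *\<^sub>R w (S t)) (at t)"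
      unfolding v_def by (rule has_vector_derivative_scaleR[OF DERIV_rate[OF tI] chain]) (use sol t in auto)
    then have "(v has_vector_derivative a t) (at t)"
      by (simp add: a_def v_def power2_eq_square)
    moreover have "jet2 (t, x t, v t, a t) = (S t, y (S t), w (S t), b (S t))"
      using rate_pos[OF tI] by (simp add: jet2_def v_def a_def xy[OF t] power_inverse)
    then have "E' (t, x t, v t, a t) = 0"
      using sol[OF t] E'[OF tI] by simp
    ultimately show ?thesis using sol[OF t] xy[OF t] by simp
  qed
  show "solves_on E' U J x" unfolding solves_on_def by (intro exI ballI, rule sol')
qed

end

section \<open>Equivalence of the damped and the time-dependent system\<close>

theorem mainTheorem3:
  fixes U :: "(real^'n) set" and I :: "real set"
    and g :: "real^'n \<Rightarrow> real^'n^'n" and V :: "real^'n \<Rightarrow> real"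
    and \<phi> S T \<omega> :: "real \<Rightarrow> real"
  assumes "open U" and "riemannian_metric_on U g" and "smooth_on U V"
    and "open I" and "is_interval I" and "smooth_on I \<phi>"
    and "damping_parameter \<phi> I S"
    and "\<forall>t\<in>I. T (S t) = t"
    and "\<forall>s\<in>S ` I. \<omega> s = (deriv T s)\<^sup>2"
  shows "(\<forall>J x y. open J \<and> J \<subseteq> I \<and> (\<forall>t\<in>J. y (S t) = x t) \<longrightarrow>
            (solves_on (damped_system g V \<phi>) U J x \<longleftrightarrow>
             solves_on (timedep_system g V \<omega>) U (S ` J) y))
       \<and> (\<forall>W X. open W \<and> W \<subseteq> I \<times> U \<longrightarrow>
            (lie_point_symmetry_on (damped_system g V \<phi>) W X \<longleftrightarrow>
             (\<exists>Y. lie_point_symmetry_on (timedep_system g V \<omega>) (change_param S ` W) Y \<and>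
                  (\<forall>p\<in>W. X p = pushforward (change_param T) (change_param S) Y p))))
       \<and> (\<forall>W X. open W \<and> W \<subseteq> I \<times> U \<longrightarrow>
            (noether_point_symmetry_on (damped_lagrangian g V S) W X \<longleftrightarrow>
             (\<exists>Y. noether_point_symmetry_on (timedep_lagrangian g V \<omega>) (change_param S ` W) Y \<and>
                  (\<forall>p\<in>W. X p = pushforward (change_param T) (change_param S) Y p))))"
proof -
  interpret damping_clock I \<phi> S T
    using assms by unfold_locales auto
  interpret riemannian_chart U g V
    using assms by unfold_locales auto
  have dT: "deriv T (S t) = inverse (rate t)" if "t \<in> I" for t
    using DERIV_imp_deriv[OF DERIV_T[OF that]] .
  have \<omega>: "\<omega> (S t) = (inverse (rate t))\<^sup>2" if "t \<in> I" for t
    using assms(9) dT that by simp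
  have E: "damped_system g V \<phi> (t, x, v, a) = (rate t)\<^sup>2 *\<^sub>R timedep_system g V \<omega> (jet2 (t, x, v, a))"
    if "t \<in> I" for t x v a
    by (rule damped_system_jet2[where \<omega> = \<omega>, OF that \<omega>[OF that]])
  have L: "damped_lagrangian g V S (t, x, v) = rate t * timedep_lagrangian g V \<omega> (jet1 (t, x, v))"
    if "t \<in> I" for t x v
    using damped_lagrangian_eq[OF _ dT[OF that]] rate_pos[OF that] \<omega>[OF that]
    by (simp add: jet1_def timedep_lagrangian_def dT[OF that])
  have dE: "timedep_system g V \<omega> differentiable at (jet2 (t, x, v, a))" if "t \<in> I" "x \<in> U" for t x v a
    using differentiable_timedep_system[OF that(2) differentiable_omega[OF assms(9) that(1)]]
    by (simp add: jet2_def)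
  have dL: "timedep_lagrangian g V \<omega> differentiable at (jet1 (t, x, v))" if "t \<in> I" "x \<in> U" for t x v
    using differentiable_timedep_lagrangian[OF that(2) differentiable_omega[OF assms(9) that(1)]]
    by (simp add: jet1_def)
  show ?thesis
  proof (intro conjI allI impI; elim conjE)
    fix J and x y :: "real \<Rightarrow> real^'n"
    assume "open J" "J \<subseteq> I" "\<forall>t\<in>J. y (S t) = x t"
    then show "solves_on (damped_system g V \<phi>) U J x \<longleftrightarrow> solves_on (timedep_system g V \<omega>) U (S ` J) y"
      by (intro solves_on_reparam_iff[OF E]) auto
  next
    fix W and X :: "'n vfield"
    assume W: "open W" "W \<subseteq> I \<times> U"
    show "lie_point_symmetry_on (damped_system g V \<phi>) W X \<longleftrightarrow>
        (\<exists>Y. lie_point_symmetry_on (timedep_system g V \<omega>) (change_param S ` W) Y \<and>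
             (\<forall>p\<in>W. X p = pushforward (change_param T) (change_param S) Y p))"
    proof (rule symmetry_correspondence[OF W(1)])
      fix X Y assume "corresponding_fields I \<phi> S T W X Y"
      then show "lie_point_symmetry_on (damped_system g V \<phi>) W X \<longleftrightarrow>
          lie_point_symmetry_on (timedep_system g V \<omega>) (change_param S ` W) Y"
        by (rule corresponding_fields.lie_point_symmetry_iff) (use W(2) dE E in auto)
    qed (use W(2) in \<open>auto simp: lie_point_symmetry_on_def\<close>)
    show "noether_point_symmetry_on (damped_lagrangian g V S) W X \<longleftrightarrow>
        (\<exists>Y. noether_point_symmetry_on (timedep_lagrangian g V \<omega>) (change_param S ` W) Y \<and>
             (\<forall>p\<in>W. X p = pushforward (change_param T) (change_param S) Y p))"
    proof (rule symmetry_correspondence[OF W(1)])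
      fix X Y assume "corresponding_fields I \<phi> S T W X Y"
      then show "noether_point_symmetry_on (damped_lagrangian g V S) W X \<longleftrightarrow>
          noether_point_symmetry_on (timedep_lagrangian g V \<omega>) (change_param S ` W) Y"
        by (rule corresponding_fields.noether_point_symmetry_iff) (use W(2) dL L in auto)
    qed (use W(2) in \<open>auto simp: noether_point_symmetry_on_def\<close>)
  qed
qed

end
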